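(* There exists a universal constant $C>0$ such that for every $n\in\mathbb{N}$, every $\varepsilon\in(0,1)$ and every balanced projection $T\in \mathbb{M}_{2^n}$, at least one of the following inequalities holds: (i) $\max_{j\in[n]}\|\mathbf{d}_{j}(T)\|^{2}_{L_{2}}\ge \dfrac{C\varepsilon\log(n)}{n}$; (ii) $\max_{j\in[n]}\|\mathbf{d}_{j}(T)\|_{L_{1}}\ge \dfrac{C}{n^{(1+\varepsilon)/2}}$.
   Context: $n\ge 1$ is an integer, $[n]=\{1,\dots,n\}$. $\mathbb{M}_{2^n}=M_2(\mathbb{C})^{\otimes n}$ is the algebra of complex $2^n\times 2^n$ matrices with unit $\mathbf{1}$, equipped with the normalized trace $\mathrm{tr}$ (so $\mathrm{tr}(\mathbf{1})=1$). A projection is $T$ with $T^*=T=T^2$. $|T|=(T^*T)^{1/2}$, and for $1\le p<\infty$, $\|T\|_{L_p}=(\mathrm{tr}(|T|^p))^{1/p}$. The variance is $\mathrm{var}(T)=\mathrm{tr}(|T|^2)-|\mathrm{tr}(T)|^2$; a projection $T$ is called balanced if $\mathrm{var}(T)=\frac14$. The $j$-th partial derivative is the linear map $\mathbf{d}_j=\mathrm{id}^{\otimes(j-1)}\otimes D\otimes \mathrm{id}^{\otimes(n-j)}$ on $\mathbb{M}_{2^n}$, where $D:M_2(\mathbb{C})\to M_2(\mathbb{C})$ is $D(A)=A-\mathrm{tr}(A)\mathbf{1}_2$ ($\mathrm{tr}$ being the normalized trace on $M_2(\mathbb{C})$). *)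

theory Defs
  imports
    Complex_Main "Jordan_Normal_Form.Schur_Decomposition"
begin

text \<open>
  The algebra of complex \<open>2^n \<times> 2^n\<close> matrices is \<^term>\<open>carrier_mat (2 ^ n) (2 ^ n) :: complex mat set\<close>,
  so that \<open>n\<close> can be quantified inside a formula.
\<close>

definition ntr :: "complex mat \<Rightarrow> complex" where
  "ntr A = (\<Sum>i<dim_row A. A $$ (i, i)) / of_nat (dim_row A)"

definition projection :: "complex mat \<Rightarrow> bool" where
  "projection T \<longleftrightarrow> mat_adjoint T = T \<and> T * T = T"

text \<open>
  \<open>is_psd_powr A r B\<close>: by diagonalizing \<open>A\<close> unitarily with nonnegative eigenvalues (so \<open>A\<close> is
  positive semidefinite) and raising the eigenvalues to the power \<open>r\<close>, one obtains \<open>B = A\<^sup>r\<close>.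
  The result does not depend on the diagonalization, see \<open>is_psd_powr_unique\<close>. Note
  \<open>0 powr r = 0\<close>, which is the right convention for \<open>r > 0\<close>, the only case used.
\<close>

definition is_psd_powr :: "complex mat \<Rightarrow> real \<Rightarrow> complex mat \<Rightarrow> bool" where
  "is_psd_powr A r B \<longleftrightarrow>
     (\<exists>N U d. U \<in> carrier_mat N N \<and> mat_adjoint U * U = 1\<^sub>m N \<and> (\<forall>i<N. 0 \<le> d i) \<and>
        A = U * mat_diag N (\<lambda>i. complex_of_real (d i)) * mat_adjoint U \<and>
        B = U * mat_diag N (\<lambda>i. complex_of_real (d i powr r)) * mat_adjoint U)"

definition psd_powr :: "complex mat \<Rightarrow> real \<Rightarrow> complex mat" where
  "psd_powr A r = (THE B. is_psd_powr A r B)"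

definition mat_abs :: "complex mat \<Rightarrow> complex mat" where
  "mat_abs T = psd_powr (mat_adjoint T * T) (1 / 2)"

text \<open>The traces below are traces of positive semidefinite matrices, hence real.\<close>

definition Lp_norm :: "real \<Rightarrow> complex mat \<Rightarrow> real" where
  "Lp_norm p T = Re (ntr (psd_powr (mat_abs T) p)) powr (1 / p)"

definition variance_mat :: "complex mat \<Rightarrow> real" where
  "variance_mat T = Re (ntr (psd_powr (mat_abs T) 2)) - (cmod (ntr T))\<^sup>2"

definition balanced :: "complex mat \<Rightarrow> bool" where
  "balanced T \<longleftrightarrow> variance_mat T = 1 / 4"

definition kron :: "complex mat \<Rightarrow> complex mat \<Rightarrow> complex mat" where
  "kron A B = mat (dim_row A * dim_row B) (dim_col A * dim_col B)
     (\<lambda>(r, c). A $$ (r div dim_row B, c div dim_col B) * B $$ (r mod dim_row B, c mod dim_col B))"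

definition unit_mat :: "nat \<Rightarrow> nat \<Rightarrow> nat \<Rightarrow> complex mat" where
  "unit_mat N k l = mat N N (\<lambda>(r, c). if r = k \<and> c = l then 1 else 0)"

text \<open>
  The tensor product of linear maps \<open>\<Phi>\<close> on \<open>a \<times> a\<close> matrices and \<open>\<Psi>\<close> on \<open>b \<times> b\<close> matrices, obtained
  by expanding the argument in the basis \<open>kron (unit_mat a i k) (unit_mat b j l)\<close>; in that basis
  the coefficient of \<open>T\<close> is its entry \<open>(i * b + j, k * b + l)\<close>. The outer sum is written entrywise
  because matrices of the type \<open>mat\<close> do not form an additive monoid.
\<close>

definition tensor_map ::
  "nat \<Rightarrow> nat \<Rightarrow> (complex mat \<Rightarrow> complex mat) \<Rightarrow> (complex mat \<Rightarrow> complex mat) \<Rightarrow>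
     complex mat \<Rightarrow> complex mat" where
  "tensor_map a b \<Phi> \<Psi> T = mat (a * b) (a * b)
     (\<lambda>rc. \<Sum>i<a. \<Sum>k<a. \<Sum>j<b. \<Sum>l<b.
        T $$ (i * b + j, k * b + l) * kron (\<Phi> (unit_mat a i k)) (\<Psi> (unit_mat b j l)) $$ rc)"

definition D_map :: "complex mat \<Rightarrow> complex mat" where
  "D_map A = A - ntr A \<cdot>\<^sub>m 1\<^sub>m 2"

definition partial_deriv :: "nat \<Rightarrow> nat \<Rightarrow> complex mat \<Rightarrow> complex mat" where
  "partial_deriv n j =
     tensor_map (2 ^ (j - 1)) (2 * 2 ^ (n - j)) id (tensor_map 2 (2 ^ (n - j)) D_map id)"

lemma mat_adjoint_carrier: "U \<in> carrier_mat m k \<Longrightarrow> mat_adjoint U \<in> carrier_mat k m"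
  unfolding mat_adjoint_def by (auto simp: mat_of_rows_def)

lemma is_psd_powr_unique:
  assumes "is_psd_powr A r B" "is_psd_powr A r C"
  shows "B = C"
proof -
  obtain N U d where U: "U \<in> carrier_mat N N" "mat_adjoint U * U = 1\<^sub>m N" "\<forall>i<N. 0 \<le> d i"
    and AU: "A = U * mat_diag N (\<lambda>i. complex_of_real (d i)) * mat_adjoint U"
    and B: "B = U * mat_diag N (\<lambda>i. complex_of_real (d i powr r)) * mat_adjoint U"
    using assms(1) unfolding is_psd_powr_def by blast
  obtain M V e where V: "V \<in> carrier_mat M M" "mat_adjoint V * V = 1\<^sub>m M" "\<forall>i<M. 0 \<le> e i"
    and AV: "A = V * mat_diag M (\<lambda>i. complex_of_real (e i)) * mat_adjoint V"
    and C: "C = V * mat_diag M (\<lambda>i. complex_of_real (e i powr r)) * mat_adjoint V"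
    using assms(2) unfolding is_psd_powr_def by blast
  have "dim_row A = N" "dim_row A = M" using U(1) V(1) by (subst AU, simp, subst AV, simp)
  then have MN: "M = N" by simp
  note V = V[unfolded MN] and AV = AV[unfolded MN] and C = C[unfolded MN]
  let ?D = "\<lambda>f. mat_diag N (\<lambda>i. complex_of_real (f i))"
  let ?U' = "mat_adjoint U" and ?V' = "mat_adjoint V"
  let ?d = "\<lambda>i. d i powr r" and ?e = "\<lambda>i. e i powr r"
  note cU = U(1) mat_adjoint_carrier[OF U(1)] and cV = V(1) mat_adjoint_carrier[OF V(1)]
  have cD[simp]: "?D f \<in> carrier_mat N N" for f by simp
  have UU: "U * ?U' = 1\<^sub>m N" using mat_mult_left_right_inverse[OF cU(2,1) U(2)] .
  have VV: "V * ?V' = 1\<^sub>m N" using mat_mult_left_right_inverse[OF cV(2,1) V(2)] .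
  define W where "W = ?V' * U"
  have cW: "W \<in> carrier_mat N N" unfolding W_def using cU cV by auto
  have sandwich: "?V' * (X * F * Y) * U = (?V' * X) * F * (Y * U)"
    if "X \<in> carrier_mat N N" "F \<in> carrier_mat N N" "Y \<in> carrier_mat N N" for X F Y
    using that cU cV by (simp add: assoc_mult_mat[of _ N N _ N _ N])
  have inter: "W * ?D f = ?V' * (U * ?D f * ?U') * U"
       "?D f * W = ?V' * (V * ?D f * ?V') * U" for f
  proof -
    have "W * ?D f \<in> carrier_mat N N" by (rule mult_carrier_mat[OF cW cD])
    then show "W * ?D f = ?V' * (U * ?D f * ?U') * U"
      unfolding sandwich[OF cU(1) cD cU(2)] U(2) W_def[symmetric] by (rule right_mult_one_mat[symmetric])
    show "?D f * W = ?V' * (V * ?D f * ?V') * U"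
      unfolding sandwich[OF cV(1) cD cV(2)] V(2) W_def[symmetric]
      by (subst left_mult_one_mat[OF cD]) simp
  qed
  have "W * ?D d = ?D e * W" unfolding inter AU[symmetric] AV[symmetric] ..
  then have mm: "mat N N (\<lambda>(i, j). W $$ (i, j) * complex_of_real (d j)) =
      mat N N (\<lambda>(i, j). complex_of_real (e i) * W $$ (i, j))"
    unfolding mat_diag_mult_left[OF cW] mat_diag_mult_right[OF cW] .
  have ent: "W $$ (i, j) * complex_of_real (d j) = complex_of_real (e i) * W $$ (i, j)"
    if "i < N" "j < N" for i j
    using arg_cong[OF mm, of "\<lambda>M. M $$ (i, j)"] that by simp
  have "W * ?D ?d = ?D ?e * W"
    unfolding mat_diag_mult_left[OF cW] mat_diag_mult_right[OF cW]
  proof (rule eq_matI, goal_cases)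
    case (1 i j)
    then have "i < N" "j < N" by auto
    with ent[of i j] show ?case by (cases "W $$ (i, j) = 0") (auto simp: mult.commute)
  qed auto
  then have eq: "?V' * B * U = ?V' * C * U" unfolding inter B[symmetric] C[symmetric] .
  have cBC: "B \<in> carrier_mat N N" "C \<in> carrier_mat N N" unfolding B C using cU cV by auto
  have undo_conj: "V * (?V' * X * U) * ?U' = X" if X: "X \<in> carrier_mat N N" for X
  proof -
    have "V * (?V' * X * U) * ?U' = (V * ?V') * X * (U * ?U')"
      using X cU cV by (simp add: assoc_mult_mat[of _ N N _ N _ N])
    then show ?thesis using X UU VV by simp
  qed
  show ?thesis using undo_conj[OF cBC(1)] undo_conj[OF cBC(2)] unfolding eq by (rule trans[OF sym])
qed

corollary psd_powr_eqI: "is_psd_powr A r B \<Longrightarrow> psd_powr A r = B"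
  unfolding psd_powr_def using is_psd_powr_unique by (blast intro: the_equality)

lemma tensor_map_kron:
  assumes A: "A \<in> carrier_mat a a" "\<Phi> A \<in> carrier_mat a a"
    "\<And>i k. i < a \<Longrightarrow> k < a \<Longrightarrow> \<Phi> (unit_mat a i k) \<in> carrier_mat a a"
    "\<And>r c. r < a \<Longrightarrow> c < a \<Longrightarrow>
       \<Phi> A $$ (r, c) = (\<Sum>i<a. \<Sum>k<a. A $$ (i, k) * \<Phi> (unit_mat a i k) $$ (r, c))"
  and B: "B \<in> carrier_mat b b" "\<Psi> B \<in> carrier_mat b b"
    "\<And>i k. i < b \<Longrightarrow> k < b \<Longrightarrow> \<Psi> (unit_mat b i k) \<in> carrier_mat b b"
    "\<And>r c. r < b \<Longrightarrow> c < b \<Longrightarrow>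
       \<Psi> B $$ (r, c) = (\<Sum>i<b. \<Sum>k<b. B $$ (i, k) * \<Psi> (unit_mat b i k) $$ (r, c))"
  shows "tensor_map a b \<Phi> \<Psi> (kron A B) = kron (\<Phi> A) (\<Psi> B)"
proof (rule eq_matI, goal_cases)
  case (1 r c)
  then have rc: "r < a * b" "c < a * b" using A(2) B(2) by (auto simp: kron_def)
  then have "b > 0" by (cases b) auto
  have dm: "r div b < a" "c div b < a" "r mod b < b" "c mod b < b"
    using rc \<open>b > 0\<close> by (auto simp: less_mult_imp_div_less)
  have lt: "i * b + j < a * b" if "i < a" "j < b" for i j
  proof -
    have "i * b + j < Suc i * b" using that by simp
    also have "\<dots> \<le> a * b" using that by (intro mult_right_mono) auto
    finally show ?thesis .
  qed
  have 1: "kron A B $$ (i * b + j, k * b + l) = A $$ (i, k) * B $$ (j, l)"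
    if "i < a" "k < a" "j < b" "l < b" for i j k l
    using that A(1) B(1) lt by (simp add: kron_def)
  have 2: "kron (\<Phi> (unit_mat a i k)) (\<Psi> (unit_mat b j l)) $$ (r, c) =
      \<Phi> (unit_mat a i k) $$ (r div b, c div b) * \<Psi> (unit_mat b j l) $$ (r mod b, c mod b)"
    if "i < a" "k < a" "j < b" "l < b" for i j k l
  proof -
    have "dim_row (\<Phi> (unit_mat a i k)) = a" "dim_col (\<Phi> (unit_mat a i k)) = a"
      "dim_row (\<Psi> (unit_mat b j l)) = b" "dim_col (\<Psi> (unit_mat b j l)) = b"
      using A(3)[OF that(1,2)] B(3)[OF that(3,4)] by auto
    then show ?thesis using rc by (simp add: kron_def)
  qed
  have "tensor_map a b \<Phi> \<Psi> (kron A B) $$ (r, c) =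
    (\<Sum>i<a. \<Sum>k<a. \<Sum>j<b. \<Sum>l<b. (A $$ (i, k) * B $$ (j, l)) *
      (\<Phi> (unit_mat a i k) $$ (r div b, c div b) * \<Psi> (unit_mat b j l) $$ (r mod b, c mod b)))"
    using rc by (simp add: tensor_map_def 1 2)
  also have "\<dots> = (\<Sum>i<a. \<Sum>k<a. A $$ (i, k) * \<Phi> (unit_mat a i k) $$ (r div b, c div b)) *
    (\<Sum>j<b. \<Sum>l<b. B $$ (j, l) * \<Psi> (unit_mat b j l) $$ (r mod b, c mod b))"
    by (simp only: sum_distrib_right) (simp only: sum_distrib_left mult_ac)
  also have "\<dots> = \<Phi> A $$ (r div b, c div b) * \<Psi> B $$ (r mod b, c mod b)"
    using A(4)[OF dm(1,2)] B(4)[OF dm(3,4)] by simp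
  also have "\<dots> = kron (\<Phi> A) (\<Psi> B) $$ (r, c)"
    using rc A(2) B(2) by (simp add: kron_def)
  finally show ?case .
qed (use A(2) B(2) in \<open>auto simp: tensor_map_def kron_def\<close>)

lemma tensor_map_expand:
  assumes "r < a * b" "c < a * b"
  shows "tensor_map a b \<Phi> \<Psi> T $$ (r, c) =
    (\<Sum>I<a * b. \<Sum>K<a * b. T $$ (I, K) * tensor_map a b \<Phi> \<Psi> (unit_mat (a * b) I K) $$ (r, c))"
proof -
  let ?G = "\<lambda>i k j l. kron (\<Phi> (unit_mat a i k)) (\<Psi> (unit_mat b j l)) $$ (r, c)"
  let ?m = "a * b"
  have lt: "i * b + j < a * b" if "i < a" "j < b" for i j
  proof -
    have "i * b + j < Suc i * b" using that by simp
    also have "\<dots> \<le> a * b" using that by (intro mult_right_mono) auto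
    finally show ?thesis .
  qed
  have "(\<Sum>I<?m. \<Sum>K<?m. T $$ (I, K) * tensor_map a b \<Phi> \<Psi> (unit_mat ?m I K) $$ (r, c)) =
    (\<Sum>I<?m. \<Sum>K<?m. \<Sum>i<a. \<Sum>k<a. \<Sum>j<b. \<Sum>l<b.
       if i * b + j = I \<and> k * b + l = K then T $$ (I, K) * ?G i k j l else 0)"
    using assms lt
    by (intro sum.cong refl)
      (auto simp: tensor_map_def unit_mat_def sum_distrib_left if_distrib if_distribR intro!: sum.cong)
  also have "\<dots> = (\<Sum>i<a. \<Sum>k<a. \<Sum>j<b. \<Sum>l<b. \<Sum>I<?m. \<Sum>K<?m.
       if i * b + j = I \<and> k * b + l = K then T $$ (I, K) * ?G i k j l else 0)"
    by (simp only: sum.swap[of _ "{..<b}" "{..<?m}"] sum.swap[of _ "{..<a}" "{..<?m}"])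
  also have "\<dots> = (\<Sum>i<a. \<Sum>k<a. \<Sum>j<b. \<Sum>l<b. T $$ (i * b + j, k * b + l) * ?G i k j l)"
  proof (intro sum.cong refl, goal_cases)
    case (1 i k j l)
    have "(\<Sum>I<?m. \<Sum>K<?m. if i * b + j = I \<and> k * b + l = K then T $$ (I, K) * ?G i k j l else 0) =
      (\<Sum>I<?m. if i * b + j = I then
         (\<Sum>K<?m. if k * b + l = K then T $$ (I, K) * ?G i k j l else 0) else 0)"
      by (intro sum.cong refl) auto
    with 1 lt show ?case by (simp add: sum.delta')
  qed
  finally show ?thesis using assms by (simp add: tensor_map_def)
qed

lemma unit_mat_expand:
  assumes "r < a" "c < a"
  shows "A $$ (r, c) = (\<Sum>i<a. \<Sum>k<a. A $$ (i, k) * unit_mat a i k $$ (r, c))"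
proof -
  have "(\<Sum>i<a. \<Sum>k<a. A $$ (i, k) * unit_mat a i k $$ (r, c)) =
    (\<Sum>i<a. if r = i then (\<Sum>k<a. if c = k then A $$ (i, k) else 0) else 0)"
    using assms by (intro sum.cong refl) (auto simp: unit_mat_def if_distrib cong: if_cong)
  with assms show ?thesis by (simp add: sum.delta')
qed

lemma D_map_expand:
  assumes "A \<in> carrier_mat 2 2" "r < 2" "c < 2"
  shows "D_map A $$ (r, c) = (\<Sum>i<2. \<Sum>k<2. A $$ (i, k) * D_map (unit_mat 2 i k) $$ (r, c))"
proof -
  have "r = 0 \<or> r = 1" "c = 0 \<or> c = 1" using assms by auto
  with assms(1) show ?thesis
    by (auto simp: D_map_def ntr_def unit_mat_def numeral_2_eq_2 lessThan_Suc field_simps)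
qed

lemma partial_deriv_kron:
  assumes j: "1 \<le> j" "j \<le> n"
    and A: "A \<in> carrier_mat (2 ^ (j - 1)) (2 ^ (j - 1))"
    and X: "X \<in> carrier_mat 2 2"
    and B: "B \<in> carrier_mat (2 ^ (n - j)) (2 ^ (n - j))"
  shows "partial_deriv n j (kron A (kron X B)) = kron A (kron (D_map X) B)"
proof -
  let ?b = "2 ^ (n - j)"
  have X': "D_map X \<in> carrier_mat 2 2" using X by (auto simp: D_map_def)
  have uc: "unit_mat N i k \<in> carrier_mat N N" for N i k by (simp add: unit_mat_def)
  have Dc: "D_map (unit_mat 2 i k) \<in> carrier_mat 2 2" for i k by (auto simp: D_map_def)
  have id_exp: "id Y $$ (r, c) = (\<Sum>i<N. \<Sum>k<N. Y $$ (i, k) * id (unit_mat N i k) $$ (r, c))"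
    if "r < N" "c < N" for N r c Y
    unfolding id_apply using that by (rule unit_mat_expand)
  have idc: "id Y \<in> carrier_mat N N" if "Y \<in> carrier_mat N N" for Y :: "complex mat" and N
    using that by simp
  have inner: "tensor_map 2 ?b D_map id (kron X B) = kron (D_map X) (id B)"
    by (rule tensor_map_kron[OF X X' Dc D_map_expand[OF X] B idc[OF B] idc[OF uc] id_exp])
  let ?T = "tensor_map 2 ?b D_map id"
  have XB: "kron X B \<in> carrier_mat (2 * ?b) (2 * ?b)" using X B by (simp add: kron_def)
  have tc: "?T Y \<in> carrier_mat (2 * ?b) (2 * ?b)" for Y by (simp add: tensor_map_def)
  have "tensor_map (2 ^ (j - 1)) (2 * ?b) id ?T (kron A (kron X B)) = kron (id A) (?T (kron X B))"
    by (rule tensor_map_kron[OF A idc[OF A] idc[OF uc] id_exp XB tc tc tensor_map_expand])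
  then show ?thesis by (simp add: partial_deriv_def inner)
qed

end

theory Submission
  imports Defs "HOL-Analysis.L2_Norm"
begin

text \<open>
  The proof transfers the Kahn-Kalai-Linial argument from the Boolean cube to matrices. Expand
  \<open>T = \<Sum>\<^sub>s c\<^sub>s \<sigma>\<^sub>s\<close> in tensor products of Pauli matrices. This is an orthonormal expansion, the variance of
  \<open>T\<close> is \<open>\<Sum> |c\<^sub>s|\<^sup>2\<close> over the strings \<open>s\<close> other than the identity string, and the \<open>j\<close>-th partial derivative
  keeps precisely the strings that are non-trivial at position \<open>j\<close>. With \<open>|s|\<close> the number of non-trivial
  positions, every \<open>s\<close> therefore occurs in \<open>|s|\<close> of the derivatives.

  Fix a cut-off \<open>k\<close>. The strings with \<open>|s| > k\<close> contribute at most \<open>1/k\<close> times the sum of the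
  \<open>\<parallel>d\<^sub>j T\<parallel>\<^sub>2\<^sup>2\<close> to the variance. The others are seen by the depolarizing map \<open>N\<close>, which multiplies \<open>\<sigma>\<^sub>s\<close> by
  \<open>3\<^bsup>-|s|\<^esup>\<close>, and contribute at most \<open>9\<^sup>k\<close> times the sum of the \<open>\<parallel>N d\<^sub>j T\<parallel>\<^sub>2\<^sup>2\<close>; this is \<open>variance_le\<close>.

  The decisive estimate is \<open>\<parallel>N g\<parallel>\<^sub>2\<^sup>2 \<le> \<parallel>g\<parallel>\<^sub>1 \<parallel>g\<parallel>\<^sub>2\<close> for Hermitian \<open>g\<close> (\<open>depolarize_energy_le\<close>). It is dual to
  the hypercontractive inequality \<open>\<parallel>N f\<parallel>\<^sub>4 \<le> \<parallel>f\<parallel>\<^sub>2\<close> (\<open>depolarize_hypercontractive\<close>),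
  which is proved one qubit at a time: the fourth power of the 4-norm is a trace of a product of four matrices, so that
  the multiplication table of the Pauli matrices and Cauchy-Schwarz reduce the step from \<open>n\<close> to \<open>n + 1\<close>
  qubits to an inequality between four real numbers. The passage to the dual statement expresses
  \<open>tr(g h)\<close> in an eigenbasis of \<open>g\<close> (\<open>duality_bound\<close>).

  If all \<open>\<parallel>d\<^sub>j T\<parallel>\<^sub>1\<close> are at most \<open>\<alpha>\<close> and all \<open>\<parallel>d\<^sub>j T\<parallel>\<^sub>2\<close> at most \<open>\<beta>\<close>, the variance is thus at most
  \<open>9\<^sup>k n \<alpha> \<beta> + n \<beta>\<^sup>2 / k\<close> (\<open>variance_mat_le\<close>). Were both alternatives of the theorem false, then with
  \<open>L = \<epsilon> ln n\<close> this would be of the order \<open>C\<^bsup>3/2\<^esup> 9\<^sup>k exp (-L/2) sqrt L + C L / k\<close>, which is less than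
  \<open>1/4\<close> for \<open>k\<close> about \<open>L/8\<close> and small \<open>C\<close>.
\<close>

section \<open>The normalized Hilbert-Schmidt norm\<close>

text \<open>
  A matrix of size \<open>2^n\<close> is handled through its entry function: cutting it into four blocks is then
  a shift of the indices, and no dimensions have to be carried along. Only the values at indices below
  \<open>2^n\<close> matter, so statements about kernels of level \<open>n\<close> either restrict the indices or ignore the rest.
\<close>
type_synonym kernel = "nat \<Rightarrow> nat \<Rightarrow> complex"

definition hs_inner :: "nat \<Rightarrow> kernel \<Rightarrow> kernel \<Rightarrow> complex" where
  "hs_inner n f g = (\<Sum>r<2^n. \<Sum>c<2^n. cnj (f r c) * g r c) / 2 ^ n"

definition hs_norm :: "nat \<Rightarrow> kernel \<Rightarrow> real" where
  "hs_norm n f = sqrt ((\<Sum>r<2^n. \<Sum>c<2^n. (cmod (f r c))\<^sup>2) / 2 ^ n)"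

lemma hs_norm_nonneg [simp]: "0 \<le> hs_norm n f"
  by (simp add: hs_norm_def sum_nonneg)

lemma hs_norm_power2: "(hs_norm n f)\<^sup>2 = (\<Sum>r<2^n. \<Sum>c<2^n. (cmod (f r c))\<^sup>2) / 2 ^ n"
  by (simp add: hs_norm_def sum_nonneg)

lemma hs_inner_self: "hs_inner n f f = complex_of_real ((hs_norm n f)\<^sup>2)"
  by (simp only: hs_inner_def hs_norm_power2 of_real_divide of_real_sum complex_norm_square
      of_real_power[of 2 n] of_real_numeral mult.commute[of "cnj _"])

lemma hs_norm_cong:
  "(\<And>r c. r < 2 ^ n \<Longrightarrow> c < 2 ^ n \<Longrightarrow> f r c = g r c) \<Longrightarrow> hs_norm n f = hs_norm n g"
  by (simp add: hs_norm_def)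

lemma hs_norm_scale: "hs_norm n (\<lambda>r c. a * f r c) = cmod a * hs_norm n f"
  by (simp add: hs_norm_def norm_mult power_mult_distrib sum_distrib_left[symmetric]
      real_sqrt_mult flip: times_divide_eq_right)

lemma hs_norm_L2_set:
  "hs_norm n f = L2_set (\<lambda>(r, c). cmod (f r c)) ({..<2^n} \<times> {..<2^n}) / sqrt (2 ^ n)"
  by (simp add: hs_norm_def L2_set_def real_sqrt_divide sum.cartesian_product case_prod_beta)

lemma hs_norm_triangle:
  "hs_norm n (\<lambda>r c. f r c + g r c) \<le> hs_norm n f + hs_norm n g"
proof -
  let ?I = "{..<2^n} \<times> {..<2^n} :: (nat \<times> nat) set"
  have "L2_set (\<lambda>(r, c). cmod (f r c + g r c)) ?I
      \<le> L2_set (\<lambda>x. cmod (f (fst x) (snd x)) + cmod (g (fst x) (snd x))) ?I"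
    by (rule L2_set_mono) (auto simp: norm_triangle_ineq)
  also have "\<dots> \<le> L2_set (\<lambda>(r, c). cmod (f r c)) ?I + L2_set (\<lambda>(r, c). cmod (g r c)) ?I"
    unfolding case_prod_beta by (rule L2_set_triangle_ineq)
  finally show ?thesis
    by (simp add: hs_norm_L2_set divide_right_mono flip: add_divide_distrib)
qed

text \<open>
  The entries of \<open>f\<^sup>* g\<close>. Accordingly \<open>hs_norm n (gram n f f)\<close> is the square of the normalized
  4-norm of \<open>f\<close>.
\<close>
definition gram :: "nat \<Rightarrow> kernel \<Rightarrow> kernel \<Rightarrow> kernel" where
  "gram n f g = (\<lambda>r c. \<Sum>k<2^n. cnj (f k r) * g k c)"

text \<open>
  The inequality \<open>\<parallel>f\<^sup>* g\<parallel>\<^sub>2 \<le> \<parallel>f\<parallel>\<^sub>4 \<parallel>g\<parallel>\<^sub>4\<close>, in its squared form. By cyclicity of the trace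
  \<open>\<parallel>f\<^sup>* g\<parallel>\<^sub>2\<^sup>2\<close> is the inner product of \<open>f f\<^sup>*\<close> and \<open>g g\<^sup>*\<close>, and \<open>f f\<^sup>*\<close> has the same 2-norm as \<open>f\<^sup>* f\<close>;
  so Cauchy-Schwarz gives the claim.
\<close>
lemma hs_norm_gram_le:
  "(hs_norm n (gram n f g))\<^sup>2 \<le> hs_norm n (gram n f f) * hs_norm n (gram n g g)"
proof -
  let ?N = "2 ^ n :: nat"
  define S where "S h = (\<Sum>r<?N. \<Sum>c<?N. (cmod (h r c))\<^sup>2)" for h :: kernel
  \<comment> \<open>\<open>R h = h h\<^sup>*\<close>, while \<open>gram n h h = h\<^sup>* h\<close>.\<close>
  define R where "R h k l = (\<Sum>r<?N. h k r * cnj (h l r))" for h :: kernel and k l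
  have Rc: "cnj (R h k l) = R h l k" for h k l
    by (simp add: R_def mult.commute)
  have Rn: "cmod (R h k l) = cmod (R h l k)" for h k l
    unfolding Rc[symmetric, of h l k] by simp
  \<comment> \<open>Cyclicity of the trace: \<open>tr((u\<^sup>* v)(u\<^sup>* v)\<^sup>*) = tr((u u\<^sup>*)(v v\<^sup>*))\<close>.\<close>
  have swap: "of_real (S (gram n u v)) = (\<Sum>k<?N. \<Sum>l<?N. R u l k * R v k l)" for u v
  proof -
    have "of_real (S (gram n u v)) = (\<Sum>r<?N. \<Sum>c<?N. gram n u v r c * cnj (gram n u v r c))"
      by (simp add: S_def flip: complex_norm_square)
    also have "\<dots> = (\<Sum>r<?N. \<Sum>c<?N. \<Sum>k<?N. \<Sum>l<?N.
        (u l r * cnj (u k r)) * (v k c * cnj (v l c)))"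
      unfolding gram_def cnj_sum sum_product by (simp add: mult_ac)
    also have "\<dots> = (\<Sum>k<?N. \<Sum>l<?N. \<Sum>r<?N. \<Sum>c<?N.
        (u l r * cnj (u k r)) * (v k c * cnj (v l c)))"
      by (subst (2) sum.swap, subst sum.swap, subst (3) sum.swap, subst (2) sum.swap) (rule refl)
    finally show ?thesis by (simp add: R_def sum_product)
  qed
  have SR: "S (gram n u u) = S (R u)" for u
  proof -
    have "complex_of_real (S (gram n u u)) = of_real (S (R u))"
      unfolding swap by (simp only: S_def of_real_sum complex_norm_square Rc mult.commute)
    then show ?thesis using of_real_eq_iff by blast
  qed
  let ?I = "{..<?N} \<times> {..<?N}"
  have L2: "L2_set (\<lambda>(k, l). cmod (h k l)) ?I = sqrt (S h)" for h
    by (simp add: S_def L2_set_def sum.cartesian_product case_prod_beta)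
  have "S (gram n f g) = cmod (\<Sum>k<?N. \<Sum>l<?N. R f l k * R g k l)"
    unfolding swap[symmetric] norm_of_real by (simp add: S_def sum_nonneg)
  also have "\<dots> \<le> (\<Sum>k<?N. \<Sum>l<?N. cmod (R f k l) * cmod (R g k l))"
    by (intro sum_norm_le order.trans[OF norm_sum] sum_mono) (use Rn[of f] in \<open>simp add: norm_mult\<close>)
  also have "\<dots> = (\<Sum>x\<in>?I. \<bar>case x of (k, l) \<Rightarrow> cmod (R f k l)\<bar> * \<bar>case x of (k, l) \<Rightarrow> cmod (R g k l)\<bar>)"
    by (simp add: sum.cartesian_product case_prod_beta)
  also have "\<dots> \<le> sqrt (S (R f)) * sqrt (S (R g))"
    unfolding L2[symmetric] by (rule L2_set_mult_ineq)
  finally have "S (gram n f g) \<le> sqrt (S (gram n f f)) * sqrt (S (gram n g g))"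
    unfolding SR .
  then have "S (gram n f g) / 2 ^ n \<le> sqrt (S (gram n f f)) * sqrt (S (gram n g g)) / 2 ^ n"
    by (simp add: divide_right_mono)
  then show ?thesis
    unfolding hs_norm_power2 unfolding hs_norm_def S_def[symmetric] real_sqrt_divide by simp
qed

section \<open>Pauli decomposition of one qubit\<close>

datatype pauli = S0 | SX | SY | SZ

lemma UNIV_pauli: "UNIV = {S0, SX, SY, SZ}"
  using pauli.exhaust by auto

instance pauli :: finite
  by standard (simp add: UNIV_pauli)

text \<open>
  The matrices \<open>f\<^sub>i\<close> of level \<open>n\<close> in the expansion \<open>f = \<Sum>\<^sub>i \<sigma>\<^sub>i \<otimes> f\<^sub>i\<close> of a matrix of level \<open>n + 1\<close>, where
  \<open>\<sigma>\<^sub>i\<close> runs through the identity and the three Pauli matrices.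
\<close>
fun pauli_part :: "nat \<Rightarrow> pauli \<Rightarrow> kernel \<Rightarrow> kernel" where
  "pauli_part n S0 f = (\<lambda>r c. (f r c + f (2 ^ n + r) (2 ^ n + c)) / 2)"
| "pauli_part n SX f = (\<lambda>r c. (f r (2 ^ n + c) + f (2 ^ n + r) c) / 2)"
| "pauli_part n SY f = (\<lambda>r c. \<i> * (f r (2 ^ n + c) - f (2 ^ n + r) c) / 2)"
| "pauli_part n SZ f = (\<lambda>r c. (f r c - f (2 ^ n + r) (2 ^ n + c)) / 2)"

text \<open>
  The matrix \<open>\<Sum>\<^sub>i \<sigma>\<^sub>i \<otimes> p i\<close>.
\<close>
definition assemble :: "nat \<Rightarrow> (pauli \<Rightarrow> kernel) \<Rightarrow> kernel" where
  "assemble n p R C =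
    (if R < 2 ^ n
     then if C < 2 ^ n then p S0 R C + p SZ R C
          else p SX R (C - 2 ^ n) - \<i> * p SY R (C - 2 ^ n)
     else if C < 2 ^ n then p SX (R - 2 ^ n) C + \<i> * p SY (R - 2 ^ n) C
          else p S0 (R - 2 ^ n) (C - 2 ^ n) - p SZ (R - 2 ^ n) (C - 2 ^ n))"

lemma pauli_part_assemble:
  "r < 2 ^ n \<Longrightarrow> c < 2 ^ n \<Longrightarrow> pauli_part n i (assemble n p) r c = p i r c"
  by (cases i) (simp_all add: assemble_def algebra_simps)

lemma pauli_part_scale: "pauli_part n i (\<lambda>r c. a * f r c) = (\<lambda>r c. a * pauli_part n i f r c)"
  by (cases i) (simp_all add: algebra_simps)

lemma pauli_part_cong:
  assumes "\<And>r c. r < 2 ^ Suc n \<Longrightarrow> c < 2 ^ Suc n \<Longrightarrow> f r c = g r c" "r < 2 ^ n" "c < 2 ^ n"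
  shows "pauli_part n i f r c = pauli_part n i g r c"
  using assms by (cases i) simp_all

lemma sum_lessThan_double:
  "(\<Sum>r<2 ^ Suc n. h r) = (\<Sum>r<2 ^ n. h r + h (2 ^ n + r))" for h :: "nat \<Rightarrow> 'a::comm_monoid_add"
proof -
  have "(\<Sum>r<m + k. h r) = (\<Sum>r<m. h r) + (\<Sum>r<k. h (m + r))" for m k
    by (induction k) (simp_all add: add.assoc)
  from this[of "2 ^ n" "2 ^ n"] show ?thesis by (simp add: mult_2 sum.distrib)
qed

lemma sum_lessThan_double2:
  "(\<Sum>r<2 ^ Suc n. \<Sum>c<2 ^ Suc n. h r c) = (\<Sum>r<2 ^ n. \<Sum>c<2 ^ n.
     h r c + h (2 ^ n + r) (2 ^ n + c) + (h r (2 ^ n + c) + h (2 ^ n + r) c))"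
  for h :: "nat \<Rightarrow> nat \<Rightarrow> 'a::comm_monoid_add"
  by (simp only: sum_lessThan_double sum.distrib add_ac)

text \<open>
  The Pauli matrices are orthonormal for the normalized trace.
\<close>
lemma hs_inner_Suc:
  "hs_inner (Suc n) f g = (\<Sum>i\<in>UNIV. hs_inner n (pauli_part n i f) (pauli_part n i g))"
proof -
  have "hs_inner (Suc n) f g = (\<Sum>r<2^n. \<Sum>c<2^n. (cnj (f r c) * g r c +
      cnj (f (2^n+r) (2^n+c)) * g (2^n+r) (2^n+c) + (cnj (f r (2^n+c)) * g r (2^n+c) +
      cnj (f (2^n+r) c) * g (2^n+r) c)) / 2) / 2^n"
    unfolding hs_inner_def sum_lessThan_double2 sum_divide_distrib by simp
  also have "\<dots> = (\<Sum>r<2^n. \<Sum>c<2^n. \<Sum>i\<in>UNIV.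
      cnj (pauli_part n i f r c) * pauli_part n i g r c) / 2^n"
    by (intro arg_cong[where f = "\<lambda>x. x / 2^n"] sum.cong refl)
      (simp add: UNIV_pauli field_simps)
  finally show ?thesis
    by (simp only: hs_inner_def sum_divide_distrib sum.swap[where B = "UNIV :: pauli set"])
qed

lemma hs_norm_Suc:
  "(hs_norm (Suc n) f)\<^sup>2 = (\<Sum>i\<in>UNIV. (hs_norm n (pauli_part n i f))\<^sup>2)"
proof -
  have "complex_of_real ((hs_norm (Suc n) f)\<^sup>2)
      = complex_of_real (\<Sum>i\<in>UNIV. (hs_norm n (pauli_part n i f))\<^sup>2)"
    unfolding hs_inner_self[symmetric] hs_inner_Suc of_real_sum ..
  then show ?thesis by (simp only: of_real_eq_iff)
qed

text \<open>
  The multiplication table of the Pauli matrices: each of the sixteen products \<open>\<sigma>\<^sub>i \<sigma>\<^sub>j\<close> is a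
  unimodular multiple of a single \<open>\<sigma>\<^sub>k\<close>, and every \<open>\<sigma>\<^sub>k\<close> arises four times.
\<close>
lemma pauli_part_gram:
  fixes f g n defines "a \<equiv> \<lambda>i. pauli_part n i f" and "b \<equiv> \<lambda>i. pauli_part n i g"
  shows
   "pauli_part n S0 (gram (Suc n) f g) = (\<lambda>r c.
      gram n (a S0) (b S0) r c + gram n (a SX) (b SX) r c
        + (gram n (a SY) (b SY) r c + gram n (a SZ) (b SZ) r c))"
   "pauli_part n SX (gram (Suc n) f g) = (\<lambda>r c.
      gram n (a S0) (b SX) r c + gram n (a SX) (b S0) r c
        + (\<i> * gram n (a SY) (b SZ) r c + (-\<i>) * gram n (a SZ) (b SY) r c))"
   "pauli_part n SY (gram (Suc n) f g) = (\<lambda>r c.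
      gram n (a S0) (b SY) r c + gram n (a SY) (b S0) r c
        + (\<i> * gram n (a SZ) (b SX) r c + (-\<i>) * gram n (a SX) (b SZ) r c))"
   "pauli_part n SZ (gram (Suc n) f g) = (\<lambda>r c.
      gram n (a S0) (b SZ) r c + gram n (a SZ) (b S0) r c
        + (\<i> * gram n (a SX) (b SY) r c + (-\<i>) * gram n (a SY) (b SX) r c))"
  unfolding a_def b_def pauli_part.simps gram_def sum_lessThan_double sum_distrib_left
    sum_divide_distrib sum.distrib[symmetric] sum_subtractf[symmetric]
  by (intro ext sum.cong refl; simp add: field_simps)+

section \<open>Hypercontractivity of the depolarizing map\<close>

lemma hs_norm_four_le:
  "hs_norm n (\<lambda>r c. f r c + g r c + (a * h r c + b * k r c))
     \<le> hs_norm n f + hs_norm n g + (cmod a * hs_norm n h + cmod b * hs_norm n k)"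
  using hs_norm_triangle[of n "\<lambda>r c. f r c + g r c" "\<lambda>r c. a * h r c + b * k r c"]
    hs_norm_triangle[of n f g] hs_norm_triangle[of n "\<lambda>r c. a * h r c" "\<lambda>r c. b * k r c"]
  unfolding hs_norm_scale by linarith

text \<open>
  The 4-norm at level \<open>n + 1\<close> is controlled by the 4-norms \<open>q i\<close> of the Pauli parts alone: expand
  \<open>f\<^sup>* f\<close> by the multiplication table and bound each of the sixteen products by Cauchy-Schwarz.
\<close>
lemma hs_norm_gram_Suc_le:
  fixes n f defines "q \<equiv> \<lambda>i. sqrt (hs_norm n (gram n (pauli_part n i f) (pauli_part n i f)))"
  shows "(hs_norm (Suc n) (gram (Suc n) f f))\<^sup>2 \<le>
    ((q S0)\<^sup>2 + (q SX)\<^sup>2 + ((q SY)\<^sup>2 + (q SZ)\<^sup>2))\<^sup>2 + (2 * (q S0 * q SX + q SY * q SZ))\<^sup>2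
    + (2 * (q S0 * q SY + q SZ * q SX))\<^sup>2 + (2 * (q S0 * q SZ + q SX * q SY))\<^sup>2"
proof -
  let ?g = "\<lambda>i j. gram n (pauli_part n i f) (pauli_part n j f)"
  have q0: "q i \<ge> 0" for i by (simp add: q_def)
  have g: "hs_norm n (?g i j) \<le> q i * q j" for i j
  proof (rule power2_le_imp_le)
    show "(hs_norm n (?g i j))\<^sup>2 \<le> (q i * q j)\<^sup>2"
      unfolding q_def power_mult_distrib by (simp add: hs_norm_gram_le)
  qed (simp add: q0)
  have "hs_norm n (pauli_part n S0 (gram (Suc n) f f))
      \<le> (q S0)\<^sup>2 + (q SX)\<^sup>2 + ((q SY)\<^sup>2 + (q SZ)\<^sup>2)"
    unfolding pauli_part_gram power2_eq_square
    using hs_norm_four_le[of n "?g S0 S0" "?g SX SX" 1 "?g SY SY" 1 "?g SZ SZ"]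
      g[of S0 S0] g[of SX SX] g[of SY SY] g[of SZ SZ] by simp
  moreover have "hs_norm n (pauli_part n SX (gram (Suc n) f f)) \<le> 2 * (q S0 * q SX + q SY * q SZ)"
    unfolding pauli_part_gram
    using hs_norm_four_le[of n "?g S0 SX" "?g SX S0" "\<i>" "?g SY SZ" "-\<i>" "?g SZ SY"]
      g[of S0 SX] g[of SX S0] g[of SY SZ] g[of SZ SY] by (simp add: mult.commute)
  moreover have "hs_norm n (pauli_part n SY (gram (Suc n) f f)) \<le> 2 * (q S0 * q SY + q SZ * q SX)"
    unfolding pauli_part_gram
    using hs_norm_four_le[of n "?g S0 SY" "?g SY S0" "\<i>" "?g SZ SX" "-\<i>" "?g SX SZ"]
      g[of S0 SY] g[of SY S0] g[of SX SZ] g[of SZ SX] by (simp add: mult.commute)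
  moreover have "hs_norm n (pauli_part n SZ (gram (Suc n) f f)) \<le> 2 * (q S0 * q SZ + q SX * q SY)"
    unfolding pauli_part_gram
    using hs_norm_four_le[of n "?g S0 SZ" "?g SZ S0" "\<i>" "?g SX SY" "-\<i>" "?g SY SX"]
      g[of S0 SZ] g[of SZ S0] g[of SX SY] g[of SY SX] by (simp add: mult.commute)
  ultimately show ?thesis
    unfolding hs_norm_Suc UNIV_pauli by (simp add: add.assoc add_mono power_mono)
qed

text \<open>
  The \<open>n\<close>-fold tensor power of the depolarizing map \<open>A \<mapsto> \<rho> A + (1 - \<rho>) tr(A) 1\<close> on one qubit:
  that map fixes the identity and multiplies the other Pauli matrices by \<open>\<rho>\<close>.
\<close>
fun depolarize :: "real \<Rightarrow> nat \<Rightarrow> kernel \<Rightarrow> kernel" where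
  "depolarize \<rho> 0 f = f"
| "depolarize \<rho> (Suc n) f = assemble n (\<lambda>i r c.
     complex_of_real (if i = S0 then 1 else \<rho>) * depolarize \<rho> n (pauli_part n i f) r c)"

text \<open>
  The constant \<open>1/3\<close> of the depolarizing map is small enough to beat the mixed terms.
\<close>
lemma four_point_inequality:
  fixes a x y z :: real
  shows "(a\<^sup>2 + (x / 3)\<^sup>2 + ((y / 3)\<^sup>2 + (z / 3)\<^sup>2))\<^sup>2 + (2 * (a * (x / 3) + y / 3 * (z / 3)))\<^sup>2
    + (2 * (a * (y / 3) + z / 3 * (x / 3)))\<^sup>2 + (2 * (a * (z / 3) + x / 3 * (y / 3)))\<^sup>2
    \<le> (a\<^sup>2 + x\<^sup>2 + (y\<^sup>2 + z\<^sup>2))\<^sup>2"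
proof -
  have sq: "(2 * (u + v))\<^sup>2 \<le> 8 * (u\<^sup>2 + v\<^sup>2)" for u v :: real
    using zero_le_power2[of "u - v"] by (simp add: power2_eq_square algebra_simps)
  define A X Y Z where "A = a\<^sup>2" "X = x\<^sup>2" "Y = y\<^sup>2" "Z = z\<^sup>2"
  note d = this
  have nn: "A \<ge> 0" "X \<ge> 0" "Y \<ge> 0" "Z \<ge> 0" by (simp_all add: d)
  have s: "(2 * (a * (x / 3) + y / 3 * (z / 3)))\<^sup>2 \<le> 8 * (A * X / 9 + Y * Z / 81)"
    "(2 * (a * (y / 3) + z / 3 * (x / 3)))\<^sup>2 \<le> 8 * (A * Y / 9 + Z * X / 81)"
    "(2 * (a * (z / 3) + x / 3 * (y / 3)))\<^sup>2 \<le> 8 * (A * Z / 9 + X * Y / 81)"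
    by (rule order.trans[OF sq], simp add: d power_mult_distrib power_divide)+
  have "(A + X / 9 + (Y / 9 + Z / 9))\<^sup>2 + 8 * (A * X / 9 + Y * Z / 81)
     + 8 * (A * Y / 9 + Z * X / 81) + 8 * (A * Z / 9 + X * Y / 81) \<le> (A + X + (Y + Z))\<^sup>2"
  proof -
    have "(A + X + (Y + Z))\<^sup>2 - ((A + X / 9 + (Y / 9 + Z / 9))\<^sup>2 + 8 * (A * X / 9 + Y * Z / 81)
        + 8 * (A * Y / 9 + Z * X / 81) + 8 * (A * Z / 9 + X * Y / 81))
      = 80 / 81 * (X * X + Y * Y + Z * Z) + 8 / 9 * (A * X + A * Y + A * Z)
        + 152 / 81 * (X * Y + Y * Z + Z * X)"
      by (simp add: power2_eq_square field_simps)
    moreover have "\<dots> \<ge> 0" using nn by (intro add_nonneg_nonneg mult_nonneg_nonneg) simp_all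
    ultimately show ?thesis by linarith
  qed
  with s show ?thesis by (simp add: power_divide flip: d)
qed

text \<open>
  Hypercontractivity \<open>\<parallel>T f\<parallel>\<^sub>4 \<le> \<parallel>f\<parallel>\<^sub>2\<close>, squared. Since the bound for one more qubit involves only the
  norms of the Pauli parts, the inequality tensorizes by induction: the noise contributes the factors \<open>1/3\<close>,
  and what is left is an inequality between four real numbers.
\<close>
theorem depolarize_hypercontractive:
  "hs_norm n (gram n (depolarize (1/3) n f) (depolarize (1/3) n f)) \<le> (hs_norm n f)\<^sup>2"
proof (induction n arbitrary: f)
  case 0
  show ?case by (simp add: hs_norm_def gram_def norm_mult power2_eq_square)
next
  case (Suc n)
  let ?F = "depolarize (1/3) (Suc n) f"
  let ?D = "\<lambda>i. depolarize (1/3) n (pauli_part n i f)"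
  define \<rho> :: "pauli \<Rightarrow> real" where "\<rho> i = (if i = S0 then 1 else 1 / 3)" for i
  define q where "q i = sqrt (hs_norm n (gram n (pauli_part n i ?F) (pauli_part n i ?F)))" for i
  define \<alpha> where "\<alpha> i = hs_norm n (pauli_part n i f)" for i
  have q0: "q i \<ge> 0" for i by (simp add: q_def)
  have qle: "q i \<le> \<rho> i * \<alpha> i" for i
  proof -
    have "hs_norm n (gram n (pauli_part n i ?F) (pauli_part n i ?F))
        = hs_norm n (\<lambda>r c. complex_of_real ((\<rho> i)\<^sup>2) * gram n (?D i) (?D i) r c)"
      by (rule hs_norm_cong)
        (simp add: gram_def pauli_part_assemble \<rho>_def sum_distrib_left power2_eq_square)
    also have "\<dots> = (\<rho> i)\<^sup>2 * hs_norm n (gram n (?D i) (?D i))"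
      unfolding hs_norm_scale by (simp add: norm_power)
    also have "\<dots> \<le> (\<rho> i)\<^sup>2 * (\<alpha> i)\<^sup>2"
      unfolding \<alpha>_def by (intro mult_left_mono Suc.IH) simp
    finally show ?thesis
      unfolding q_def by (intro real_le_lsqrt) (simp_all add: power_mult_distrib \<rho>_def \<alpha>_def)
  qed
  have b: "q S0 \<le> \<alpha> S0" "q SX \<le> \<alpha> SX / 3" "q SY \<le> \<alpha> SY / 3" "q SZ \<le> \<alpha> SZ / 3"
    using qle[of S0] qle[of SX] qle[of SY] qle[of SZ] by (simp_all add: \<rho>_def)
  have \<alpha>0: "\<alpha> i \<ge> 0" for i by (simp add: \<alpha>_def)
  have "(hs_norm (Suc n) (gram (Suc n) ?F ?F))\<^sup>2 \<le>
    ((q S0)\<^sup>2 + (q SX)\<^sup>2 + ((q SY)\<^sup>2 + (q SZ)\<^sup>2))\<^sup>2 + (2 * (q S0 * q SX + q SY * q SZ))\<^sup>2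
    + (2 * (q S0 * q SY + q SZ * q SX))\<^sup>2 + (2 * (q S0 * q SZ + q SX * q SY))\<^sup>2"
    unfolding q_def by (rule hs_norm_gram_Suc_le)
  also have "\<dots> \<le> ((\<alpha> S0)\<^sup>2 + (\<alpha> SX / 3)\<^sup>2 + ((\<alpha> SY / 3)\<^sup>2 + (\<alpha> SZ / 3)\<^sup>2))\<^sup>2
    + (2 * (\<alpha> S0 * (\<alpha> SX / 3) + \<alpha> SY / 3 * (\<alpha> SZ / 3)))\<^sup>2
    + (2 * (\<alpha> S0 * (\<alpha> SY / 3) + \<alpha> SZ / 3 * (\<alpha> SX / 3)))\<^sup>2
    + (2 * (\<alpha> S0 * (\<alpha> SZ / 3) + \<alpha> SX / 3 * (\<alpha> SY / 3)))\<^sup>2"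
    by (intro add_mono power_mono mult_left_mono mult_mono b q0 add_nonneg_nonneg mult_nonneg_nonneg
        zero_le_power2 divide_nonneg_nonneg \<alpha>0) simp_all
  also have "\<dots> \<le> ((\<alpha> S0)\<^sup>2 + (\<alpha> SX)\<^sup>2 + ((\<alpha> SY)\<^sup>2 + (\<alpha> SZ)\<^sup>2))\<^sup>2"
    by (rule four_point_inequality)
  also have "\<dots> = ((hs_norm (Suc n) f)\<^sup>2)\<^sup>2"
    unfolding hs_norm_Suc UNIV_pauli \<alpha>_def by (simp add: add.assoc)
  finally show ?case by (rule power2_le_imp_le) simp
qed

section \<open>The Pauli expansion\<close>

text \<open>
  The coefficient of \<open>\<sigma>\<^sub>s = \<sigma>\<^bsub>s!0\<^esub> \<otimes> \<sigma>\<^bsub>s!1\<^esub> \<otimes> \<dots>\<close> in the Pauli expansion of a matrix.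
\<close>
fun pauli_coeff :: "pauli list \<Rightarrow> kernel \<Rightarrow> complex" where
  "pauli_coeff [] f = f 0 0"
| "pauli_coeff (i # s) f = pauli_coeff s (pauli_part (length s) i f)"

abbreviation pauli_strings :: "nat \<Rightarrow> pauli list set" where
  "pauli_strings n \<equiv> {s. length s = n}"

definition weight :: "pauli list \<Rightarrow> nat" where
  "weight s = length (filter (\<lambda>i. i \<noteq> S0) s)"

lemma finite_pauli_strings [simp]: "finite (pauli_strings n)"
  using finite_lists_length_eq[of "UNIV :: pauli set" n] by simp

lemma sum_pauli_strings_Suc:
  "(\<Sum>s\<in>pauli_strings (Suc n). h s) = (\<Sum>i\<in>UNIV. \<Sum>s\<in>pauli_strings n. h (i # s))"
proof -
  have "pauli_strings (Suc n) = (\<lambda>(i, s). i # s) ` (UNIV \<times> pauli_strings n)"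
    by (auto simp: length_Suc_conv image_iff)
  then have "(\<Sum>s\<in>pauli_strings (Suc n). h s) = (\<Sum>(i, s)\<in>UNIV \<times> pauli_strings n. h (i # s))"
    by (simp add: sum.reindex inj_on_def case_prod_beta)
  then show ?thesis by (simp add: sum.cartesian_product)
qed

lemma pauli_coeff_cong:
  "(\<And>r c. r < 2 ^ length s \<Longrightarrow> c < 2 ^ length s \<Longrightarrow> f r c = g r c) \<Longrightarrow> pauli_coeff s f = pauli_coeff s g"
proof (induction s arbitrary: f g)
  case (Cons i s)
  show ?case
    unfolding pauli_coeff.simps by (rule Cons.IH, rule pauli_part_cong) (use Cons.prems in auto)
qed simp

lemma pauli_coeff_scale: "pauli_coeff s (\<lambda>r c. a * f r c) = a * pauli_coeff s f"
  by (induction s arbitrary: f) (simp_all add: pauli_part_scale)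

theorem parseval:
  "hs_inner n f g = (\<Sum>s\<in>pauli_strings n. cnj (pauli_coeff s f) * pauli_coeff s g)"
proof (induction n arbitrary: f g)
  case (Suc n)
  show ?case
    unfolding hs_inner_Suc Suc sum_pauli_strings_Suc by (intro sum.cong refl) simp
qed (simp add: hs_inner_def)

corollary hs_norm_pauli_coeff:
  "(hs_norm n f)\<^sup>2 = (\<Sum>s\<in>pauli_strings n. (cmod (pauli_coeff s f))\<^sup>2)"
proof -
  have "complex_of_real ((hs_norm n f)\<^sup>2)
      = complex_of_real (\<Sum>s\<in>pauli_strings n. (cmod (pauli_coeff s f))\<^sup>2)"
    unfolding hs_inner_self[symmetric] parseval of_real_sum complex_norm_square
    by (simp only: mult.commute)
  then show ?thesis by (simp only: of_real_eq_iff)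
qed

lemma pauli_coeff_depolarize:
  "length s = n \<Longrightarrow> pauli_coeff s (depolarize \<rho> n f) = of_real (\<rho> ^ weight s) * pauli_coeff s f"
proof (induction s arbitrary: f n)
  case (Cons i s)
  then obtain m where n: "n = Suc m" "length s = m" by auto
  have "pauli_coeff (i # s) (depolarize \<rho> n f) = pauli_coeff s (\<lambda>r c.
      complex_of_real (if i = S0 then 1 else \<rho>) * depolarize \<rho> m (pauli_part m i f) r c)"
    unfolding n(1) depolarize.simps pauli_coeff.simps n(2)
    by (rule pauli_coeff_cong) (simp add: n pauli_part_assemble)
  also have "\<dots> = complex_of_real (if i = S0 then 1 else \<rho>)
      * (of_real (\<rho> ^ weight s) * pauli_coeff s (pauli_part m i f))"
    unfolding pauli_coeff_scale by (subst Cons.IH[OF n(2)]) (rule refl)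
  finally show ?case by (simp add: weight_def n)
qed (simp add: weight_def)

text \<open>
  The depolarizing map is self-adjoint, so applying it twice on one side splits evenly.
\<close>
lemma hs_inner_depolarize_twice:
  "hs_inner n g (depolarize \<rho> n (depolarize \<rho> n g)) = of_real ((hs_norm n (depolarize \<rho> n g))\<^sup>2)"
  unfolding hs_inner_self[symmetric] parseval
  by (intro sum.cong refl) (simp add: pauli_coeff_depolarize)

lemma weight_eq_0_iff: "weight s = 0 \<longleftrightarrow> s = replicate (length s) S0"
  by (induction s) (auto simp: weight_def)

lemma pauli_coeff_identity:
  "pauli_coeff (replicate n S0) f = (\<Sum>r<2 ^ n. f r r) / 2 ^ n"
proof (induction n arbitrary: f)
  case (Suc n)
  have "pauli_coeff (replicate (Suc n) S0) f
      = (\<Sum>r<2 ^ n. (f r r + f (2 ^ n + r) (2 ^ n + r)) / 2) / 2 ^ n"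
    by (simp add: Suc)
  also have "\<dots> = (\<Sum>r<2 ^ Suc n. f r r) / 2 ^ Suc n"
    unfolding sum_lessThan_double sum_divide_distrib by simp
  finally show ?case .
qed simp

section \<open>Derivatives as Fourier multipliers\<close>

text \<open>
  The partial derivative at the qubit that occupies bit \<open>m\<close> of an index, counted from the least
  significant bit; this way the definition does not depend on \<open>n\<close>. Subtracting the average over that
  qubit halves the difference between an entry and its image under the bit flip where the two
  bits agree, and changes nothing where they differ.
\<close>
definition qubit_deriv :: "nat \<Rightarrow> kernel \<Rightarrow> kernel" where
  "qubit_deriv m f = (\<lambda>r c. if bit r m = bit c m
     then (f r c - f (flip_bit m r) (flip_bit m c)) / 2 else f r c)"

text \<open>
  Bits and bit flips of the indices of the two halves of a matrix of level \<open>n + 1\<close>.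
\<close>
lemma top_bit:
  fixes r :: nat assumes "r < 2 ^ n"
  shows "\<not> bit r n" "bit (2 ^ n + r) n" "m < n \<Longrightarrow> bit (2 ^ n + r) m = bit r m"
    "flip_bit n r = 2 ^ n + r" "flip_bit n (2 ^ n + r) = r"
    "m < n \<Longrightarrow> flip_bit m (2 ^ n + r) = 2 ^ n + flip_bit m r" "m < n \<Longrightarrow> flip_bit m r < 2 ^ n"
proof -
  have tb: "take_bit n r = r" using assms by (simp add: take_bit_nat_eq_self_iff)
  have b: "m < n" if "bit r m" for m
    using that tb by (metis bit_take_bit_iff)
  show 1: "\<not> bit r n" using b by blast
  have 2: "bit (2 ^ n + r') k = (k = n \<or> bit r' k)" if "\<not> bit r' n" for k r' :: nat
    by (subst bit_disjunctive_add_iff) (use that in \<open>auto simp: bit_simps possible_bit_def\<close>)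
  show "bit (2 ^ n + r) n" "m < n \<Longrightarrow> bit (2 ^ n + r) m = bit r m" using 1 by (auto simp: 2)
  show "flip_bit n r = 2 ^ n + r" "flip_bit n (2 ^ n + r) = r"
    by (rule bit_eqI; use 1 b in \<open>auto simp: 2 bit_flip_bit_iff possible_bit_def\<close>)+
  show "flip_bit m (2 ^ n + r) = 2 ^ n + flip_bit m r" if "m < n"
  proof (rule bit_eqI)
    fix k
    have "\<not> bit (flip_bit m r) n" using that 1 by (auto simp: bit_flip_bit_iff)
    then show "bit (flip_bit m (2 ^ n + r)) k = bit (2 ^ n + flip_bit m r) k"
      using that 1 by (auto simp: 2 bit_flip_bit_iff possible_bit_def)
  qed
  show "flip_bit m r < 2 ^ n" if "m < n"
    using that tb by (metis leD take_bit_flip_bit_eq take_bit_nat_less_exp)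
qed

lemma pauli_part_qubit_deriv_top:
  assumes "r < 2 ^ n" "c < 2 ^ n"
  shows "pauli_part n i (qubit_deriv n f) r c = (if i = S0 then 0 else 1) * pauli_part n i f r c"
  using assms by (cases i; simp add: qubit_deriv_def top_bit; simp add: field_simps)

lemma pauli_part_qubit_deriv:
  assumes "m < n" "r < 2 ^ n" "c < 2 ^ n"
  shows "pauli_part n i (qubit_deriv m f) r c = qubit_deriv m (pauli_part n i f) r c"
  using assms by (cases i; simp add: qubit_deriv_def top_bit; simp add: field_simps)

text \<open>
  Bit \<open>m\<close> belongs to the tensor factor in position \<open>length s - 1 - m\<close>, since the first factor
  is the most significant one. The derivative deletes the Pauli strings that are trivial there.
\<close>
lemma pauli_coeff_qubit_deriv:
  "m < length s \<Longrightarrow> pauli_coeff s (qubit_deriv m f) =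
     (if s ! (length s - 1 - m) = S0 then 0 else 1) * pauli_coeff s f"
proof (induction s arbitrary: f)
  case (Cons i s)
  show ?case
  proof (cases "m = length s")
    case True
    have "pauli_coeff (i # s) (qubit_deriv m f)
        = pauli_coeff s (\<lambda>r c. (if i = S0 then 0 else 1) * pauli_part m i f r c)"
      unfolding pauli_coeff.simps
      by (rule pauli_coeff_cong) (simp only: True pauli_part_qubit_deriv_top)
    then show ?thesis by (simp add: pauli_coeff_scale True)
  next
    case False
    with Cons.prems have m: "m < length s" by simp
    then have "(i # s) ! (length (i # s) - 1 - m) = s ! (length s - 1 - m)"
      by (simp add: nth_Cons' )
    moreover have "pauli_coeff (i # s) (qubit_deriv m f)
        = pauli_coeff s (qubit_deriv m (pauli_part (length s) i f))"
      unfolding pauli_coeff.simps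
      by (rule pauli_coeff_cong) (simp only: m pauli_part_qubit_deriv)
    ultimately show ?thesis using Cons.IH[OF m] by simp
  qed
qed simp

lemma card_nontrivial_sites:
  "(\<Sum>m<length s. if s ! (length s - 1 - m) = S0 then 0 else 1) = real (weight s)"
proof (induction s)
  case (Cons i s)
  have "(\<Sum>m<length s. if (i # s) ! (length s - m) = S0 then 0 else 1)
      = (\<Sum>m<length s. if s ! (length s - 1 - m) = S0 then 0 else 1 :: real)"
    by (intro sum.cong refl) (simp add: nth_Cons')
  with Cons show ?case by (simp add: weight_def)
qed (simp add: weight_def)

text \<open>
  A string \<open>s\<close> survives in exactly \<open>weight s\<close> of the derivatives, and the noise damps it by
  \<open>\<rho> ^ weight s\<close>.
\<close>
lemma sum_hs_norm_depolarize_qubit_deriv: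
  fixes \<rho> :: real
  shows
  "(\<Sum>m<n. (hs_norm n (depolarize \<rho> n (qubit_deriv m f)))\<^sup>2) =
   (\<Sum>s\<in>pauli_strings n. weight s * \<rho> ^ (2 * weight s) * (cmod (pauli_coeff s f))\<^sup>2)"
proof -
  have "(\<Sum>m<n. (hs_norm n (depolarize \<rho> n (qubit_deriv m f)))\<^sup>2) =
    (\<Sum>m<n. \<Sum>s\<in>pauli_strings n. (if s ! (length s - 1 - m) = S0 then 0 else 1) *
       (\<rho> ^ (2 * weight s) * (cmod (pauli_coeff s f))\<^sup>2))"
    unfolding hs_norm_pauli_coeff
    by (intro sum.cong refl) (simp add: pauli_coeff_depolarize pauli_coeff_qubit_deriv norm_mult
        norm_power power_mult_distrib power_mult[symmetric] mult.commute[of 2] power_even_abs)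
  also have "\<dots> = (\<Sum>s\<in>pauli_strings n. (\<Sum>m<n. if s ! (length s - 1 - m) = S0 then 0 else 1) *
       (\<rho> ^ (2 * weight s) * (cmod (pauli_coeff s f))\<^sup>2))"
    by (subst sum.swap) (simp only: sum_distrib_right)
  also have "\<dots> = (\<Sum>s\<in>pauli_strings n. weight s * \<rho> ^ (2 * weight s) * (cmod (pauli_coeff s f))\<^sup>2)"
    by (intro sum.cong refl) (auto simp flip: card_nontrivial_sites)
  finally show ?thesis .
qed

lemma depolarize_1: "hs_norm n (depolarize 1 n f) = hs_norm n f"
proof -
  have "(hs_norm n (depolarize 1 n f))\<^sup>2 = (hs_norm n f)\<^sup>2"
    unfolding hs_norm_pauli_coeff by (intro sum.cong refl) (simp add: pauli_coeff_depolarize)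
  then show ?thesis by simp
qed

text \<open>
  The strings of weight at most \<open>k\<close> are recovered from the noisy derivatives at the price of a
  factor \<open>9 ^ k\<close>, because damping by \<open>1/3\<close> costs at most \<open>9 ^ k\<close> in squared norm. The heavier ones occur in
  more than \<open>k\<close> derivatives, which gains the factor \<open>1/k\<close> over the total squared norm.
\<close>
theorem variance_le:
  assumes k: "k \<ge> 1"
  shows "(hs_norm n f)\<^sup>2 - (cmod ((\<Sum>r<2 ^ n. f r r) / 2 ^ n))\<^sup>2 \<le>
    9 ^ k * (\<Sum>m<n. (hs_norm n (depolarize (1/3) n (qubit_deriv m f)))\<^sup>2)
    + (\<Sum>m<n. (hs_norm n (qubit_deriv m f))\<^sup>2) / k"
proof -
  define a where "a s = (cmod (pauli_coeff s f))\<^sup>2" for s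
  let ?e = "replicate n S0"
  have "(hs_norm n f)\<^sup>2 - (cmod ((\<Sum>r<2 ^ n. f r r) / 2 ^ n))\<^sup>2 = (\<Sum>s\<in>pauli_strings n - {?e}. a s)"
    unfolding hs_norm_pauli_coeff a_def pauli_coeff_identity[symmetric]
    by (subst sum.remove[of _ ?e]) simp_all
  also have "\<dots> \<le> (\<Sum>s\<in>pauli_strings n - {?e}.
      (9 ^ k * (weight s * (1/3) ^ (2 * weight s)) + weight s * 1 ^ (2 * weight s) / k) * a s)"
  proof (rule sum_mono)
    fix s assume "s \<in> pauli_strings n - {?e}"
    then have w: "weight s \<ge> 1" using weight_eq_0_iff[of s] by (cases "weight s") auto
    have "1 \<le> 9 ^ k * (weight s * (1/3) ^ (2 * weight s)) + weight s / real k"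
    proof (cases "weight s \<le> k")
      case True
      have "1 \<le> (9::real) ^ (k - weight s) * weight s"
        using mult_mono[of 1 "9 ^ (k - weight s)" 1 "real (weight s)"] w by simp
      also have "\<dots> = 9 ^ k * (weight s * (1/3) ^ (2 * weight s))"
        using True power_mult[of "3::real" 2 "weight s"] by (simp add: power_diff power_one_over)
      finally show ?thesis by (simp add: add_increasing2)
    next
      case False
      then have "1 \<le> weight s / real k" using k by simp
      then show ?thesis by (simp add: add_increasing)
    qed
    then show "a s \<le> (9 ^ k * (weight s * (1/3) ^ (2 * weight s))
        + weight s * 1 ^ (2 * weight s) / k) * a s"
      using mult_right_mono[of 1 _ "a s"] by (simp add: a_def)
  qed
  also have "\<dots> \<le> (\<Sum>s\<in>pauli_strings n.
      (9 ^ k * (weight s * (1/3) ^ (2 * weight s)) + weight s * 1 ^ (2 * weight s) / k) * a s)"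
    by (rule sum_mono2) (auto simp: a_def)
  also have "\<dots> = 9 ^ k * (\<Sum>s\<in>pauli_strings n. weight s * (1/3) ^ (2 * weight s) * a s)
      + (\<Sum>s\<in>pauli_strings n. weight s * 1 ^ (2 * weight s) * a s) / k"
    unfolding sum_distrib_left sum_divide_distrib sum.distrib[symmetric]
    by (intro sum.cong refl) (simp add: algebra_simps)
  also have "\<dots> = 9 ^ k * (\<Sum>m<n. (hs_norm n (depolarize (1/3) n (qubit_deriv m f)))\<^sup>2)
    + (\<Sum>m<n. (hs_norm n (depolarize 1 n (qubit_deriv m f)))\<^sup>2) / k"
    unfolding sum_hs_norm_depolarize_qubit_deriv a_def by simp
  finally show ?thesis unfolding depolarize_1 .
qed

section \<open>The spectral theorem and the norms of Hermitian matrices\<close>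

lemma mat_adjoint_index:
  "A \<in> carrier_mat m k \<Longrightarrow> i < k \<Longrightarrow> j < m \<Longrightarrow> mat_adjoint A $$ (i, j) = cnj (A $$ (j, i))"
  by (auto simp: mat_adjoint_def mat_of_rows_index)

lemma mat_mult_index:
  "A \<in> carrier_mat m k \<Longrightarrow> B \<in> carrier_mat k l \<Longrightarrow> i < m \<Longrightarrow> j < l \<Longrightarrow>
     (A * B) $$ (i, j) = (\<Sum>r<k. A $$ (i, r) * B $$ (r, j))"
  by (auto simp: scalar_prod_def atLeast0LessThan)

lemma mat_adjoint_mult:
  fixes A B :: "complex mat"
  assumes A: "A \<in> carrier_mat m k" and B: "B \<in> carrier_mat k l"
  shows "mat_adjoint (A * B) = mat_adjoint B * mat_adjoint A"
proof (rule eq_matI)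
  note c = mult_carrier_mat[OF A B] mat_adjoint_carrier[OF A] mat_adjoint_carrier[OF B]
    mat_adjoint_carrier[OF mult_carrier_mat[OF A B]]
  show "dim_row (mat_adjoint (A * B)) = dim_row (mat_adjoint B * mat_adjoint A)"
    "dim_col (mat_adjoint (A * B)) = dim_col (mat_adjoint B * mat_adjoint A)"
    using c by auto
  fix i j assume "i < dim_row (mat_adjoint B * mat_adjoint A)" "j < dim_col (mat_adjoint B * mat_adjoint A)"
  then have ij: "i < l" "j < m" using c by auto
  show "mat_adjoint (A * B) $$ (i, j) = (mat_adjoint B * mat_adjoint A) $$ (i, j)"
    using A B c ij by (simp add: mat_adjoint_index[of _ m l] mat_mult_index[of _ m k _ l]
      mat_mult_index[of _ l k _ m] mat_adjoint_index[of _ m k] mat_adjoint_index[of _ k l] mult.commute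
      del: index_mult_mat)
qed

lemma unitary_diag_index:
  assumes U: "U \<in> carrier_mat N N" and ij: "i < N" "j < N"
  shows "(U * mat_diag N e * mat_adjoint U) $$ (i, j) = (\<Sum>k<N. U $$ (i, k) * e k * cnj (U $$ (j, k)))"
proof -
  note Ua = mat_adjoint_carrier[OF U]
  have "U * mat_diag N e \<in> carrier_mat N N" using U by (metis mat_diag_dim mult_carrier_mat)
  then have "(U * mat_diag N e * mat_adjoint U) $$ (i, j)
      = (\<Sum>k<N. (U * mat_diag N e) $$ (i, k) * mat_adjoint U $$ (k, j))"
    using Ua ij by (rule mat_mult_index)
  then show ?thesis
    using U ij by (simp add: mat_diag_mult_right[OF U] mat_adjoint_index[OF U])
qed

lemma unitary_index:
  assumes U: "U \<in> carrier_mat N N" "mat_adjoint U * U = 1\<^sub>m N" and ij: "i < N" "j < N"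
  shows "(\<Sum>k<N. cnj (U $$ (k, i)) * U $$ (k, j)) = (if i = j then 1 else 0)"
    and "(\<Sum>k<N. U $$ (i, k) * cnj (U $$ (j, k))) = (if i = j then 1 else 0)"
proof -
  note Ua = mat_adjoint_carrier[OF U(1)]
  have UU: "U * mat_adjoint U = 1\<^sub>m N" using mat_mult_left_right_inverse[OF Ua U(1,2)] .
  show "(\<Sum>k<N. cnj (U $$ (k, i)) * U $$ (k, j)) = (if i = j then 1 else 0)"
    using mat_mult_index[OF Ua U(1) ij] ij unfolding U(2) by (simp add: mat_adjoint_index[OF U(1)])
  show "(\<Sum>k<N. U $$ (i, k) * cnj (U $$ (j, k))) = (if i = j then 1 else 0)"
    using mat_mult_index[OF U(1) Ua ij] ij unfolding UU by (simp add: mat_adjoint_index[OF U(1)])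
qed

lemma unitaryI:
  assumes U: "U \<in> carrier_mat N N"
    and "\<And>i j. i < N \<Longrightarrow> j < N \<Longrightarrow> (\<Sum>k<N. cnj (U $$ (k, i)) * U $$ (k, j)) = (if i = j then 1 else 0)"
  shows "mat_adjoint U * U = 1\<^sub>m N"
proof (rule eq_matI)
  note Ua = mat_adjoint_carrier[OF U(1)]
  fix i j assume "i < dim_row (1\<^sub>m N)" "j < dim_col (1\<^sub>m N)"
  then have ij: "i < N" "j < N" by auto
  show "(mat_adjoint U * U) $$ (i, j) = 1\<^sub>m N $$ (i, j)"
    unfolding mat_mult_index[OF Ua U ij] using assms(2)[OF ij] ij U by (simp add: mat_adjoint_index)
qed (use U mat_adjoint_carrier[OF U] in auto)

text \<open>
  Complete \<open>v\<close> to a basis and apply Gram-Schmidt, which leaves the first vector unchanged; the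
  orthogonal vectors still have to be normalized.
\<close>
lemma unitary_with_first_column:
  fixes v :: "complex vec"
  assumes v: "v \<in> carrier_vec n" and v0: "v \<noteq> 0\<^sub>v n"
  obtains W c where "W \<in> carrier_mat n n" "mat_adjoint W * W = 1\<^sub>m n"
    "\<And>r. r < n \<Longrightarrow> W $$ (r, 0) = c * v $ r"
proof -
  interpret cof_vec_space n "TYPE(complex)" .
  define b where "b = basis_completion v"
  define ws where "ws = gram_schmidt n b"
  have n: "n > 0" using v v0 by (cases n) auto
  from basis_completion[OF v v0, folded b_def]
  have b: "distinct b" "\<not> lin_dep (set b)" "set b \<subseteq> carrier_vec n" "hd b = v" "length b = n"
    by auto
  then obtain vs where bv: "b = v # vs" using n by (cases b) auto
  from gram_schmidt_result[OF b(3,1,2) refl, folded ws_def] b(5)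
  have ws: "set ws \<subseteq> carrier_vec n" "corthogonal ws" "length ws = n" by auto
  have hdws: "ws ! 0 = v"
    using gram_schmidt_hd[OF v, of vs, folded bv] ws(3) n unfolding ws_def[symmetric]
    by (metis hd_conv_nth length_greater_0_conv)
  define s where "s c = (\<Sum>k<n. (cmod (ws ! c $ k))\<^sup>2)" for c
  have wc: "ws ! i \<in> carrier_vec n" if "i < n" for i using ws that by auto
  have ip: "ws ! j \<bullet>c ws ! i = (\<Sum>k<n. cnj (ws ! i $ k) * ws ! j $ k)" if "i < n" "j < n" for i j
    using wc[OF that(1)] wc[OF that(2)] by (simp add: scalar_prod_def atLeast0LessThan mult.commute)
  have orth: "(\<Sum>k<n. cnj (ws ! i $ k) * ws ! j $ k) = 0 \<longleftrightarrow> i \<noteq> j" if "i < n" "j < n" for i j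
    using ws(2,3) that unfolding corthogonal_def ip[OF that, symmetric] by auto
  have ss: "(\<Sum>k<n. cnj (ws ! i $ k) * ws ! i $ k) = of_real (s i)" for i
    unfolding s_def of_real_sum complex_norm_square by (simp only: mult.commute)
  have s0: "s i > 0" if "i < n" for i
  proof -
    have "s i \<noteq> 0" using orth[OF that that] ss[of i] by auto
    moreover have "s i \<ge> 0" by (simp add: s_def sum_nonneg)
    ultimately show ?thesis by simp
  qed
  define W where "W = mat n n (\<lambda>(r, c). ws ! c $ r / of_real (sqrt (s c)))"
  have W: "W \<in> carrier_mat n n" by (simp add: W_def)
  have "mat_adjoint W * W = 1\<^sub>m n"
  proof (rule unitaryI[OF W])
    fix i j assume ij: "i < n" "j < n"
    have "(\<Sum>k<n. cnj (W $$ (k, i)) * W $$ (k, j)) = (\<Sum>k<n. cnj (ws ! i $ k) * ws ! j $ k)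
        / (of_real (sqrt (s i)) * of_real (sqrt (s j)))"
      unfolding sum_divide_distrib by (intro sum.cong refl) (simp add: W_def ij)
    also have "\<dots> = (if i = j then 1 else 0)"
      using orth[OF ij] s0[OF ij(1)] by (auto simp: ss simp flip: of_real_mult)
    finally show "(\<Sum>k<n. cnj (W $$ (k, i)) * W $$ (k, j)) = (if i = j then 1 else 0)" .
  qed
  moreover have "W $$ (r, 0) = (1 / of_real (sqrt (s 0))) * v $ r" if "r < n" for r
    using that n by (simp add: W_def hdws)
  ultimately show thesis using that W by blast
qed

text \<open>
  Deflation: in an orthonormal basis starting with an eigenvector, the first column of a Hermitian
  matrix vanishes off the diagonal, hence so does the first row, and the remaining block is Hermitian again.
\<close>
theorem hermitian_diagonalization:
  fixes A :: "complex mat"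
  assumes "A \<in> carrier_mat N N" "mat_adjoint A = A"
  shows "\<exists>U (d :: nat \<Rightarrow> real). U \<in> carrier_mat N N \<and> mat_adjoint U * U = 1\<^sub>m N \<and>
    A = U * mat_diag N (\<lambda>i. of_real (d i)) * mat_adjoint U"
  using assms
proof (induction N arbitrary: A)
  case 0
  then show ?case by (intro exI[of _ A]) (auto intro!: eq_matI simp: mat_adjoint_def)
next
  case (Suc N)
  let ?N = "Suc N"
  note A = Suc.prems(1) and hA = Suc.prems(2)
  obtain es where es: "char_poly A = (\<Prod>a\<leftarrow>es. [:- a, 1:])" "length es = ?N"
    using char_poly_factorized[OF A] by blast
  then obtain e es' where "es = e # es'" by (cases es) auto
  then have "eigenvalue A e" unfolding eigenvalue_root_char_poly[OF A] es(1) by simp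
  then obtain v where v: "v \<in> carrier_vec ?N" "v \<noteq> 0\<^sub>v ?N" "A *\<^sub>v v = e \<cdot>\<^sub>v v"
    using A unfolding eigenvalue_def eigenvector_def by auto
  obtain W c where W: "W \<in> carrier_mat ?N ?N" "mat_adjoint W * W = 1\<^sub>m ?N"
    and W0: "\<And>r. r < ?N \<Longrightarrow> W $$ (r, 0) = c * v $ r"
    using unitary_with_first_column[OF v(1,2)] by blast
  note Wa = mat_adjoint_carrier[OF W(1)]
  have WW: "W * mat_adjoint W = 1\<^sub>m ?N" using mat_mult_left_right_inverse[OF Wa W(1,2)] .
  define B where "B = mat_adjoint W * (A * W)"
  have AW: "A * W \<in> carrier_mat ?N ?N" using A W(1) by simp
  have B: "B \<in> carrier_mat ?N ?N" unfolding B_def using Wa AW by simp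
  have AB: "A = W * B * mat_adjoint W"
  proof -
    have "W * B * mat_adjoint W = (W * mat_adjoint W) * A * (W * mat_adjoint W)"
      unfolding B_def using A W(1) Wa by (simp add: assoc_mult_mat[of _ ?N ?N _ ?N _ ?N])
    then show ?thesis using A by (simp add: WW)
  qed
  have adj_adj: "mat_adjoint (mat_adjoint W) = W"
    by (rule eq_matI) (use W(1) Wa mat_adjoint_carrier[OF Wa] in \<open>auto simp: mat_adjoint_index[OF Wa] mat_adjoint_index[OF W(1)]\<close>)
  have hB: "mat_adjoint B = B"
    unfolding B_def mat_adjoint_mult[OF Wa AW] mat_adjoint_mult[OF A W(1)] hA adj_adj
    using A W(1) Wa by (simp add: assoc_mult_mat[of _ ?N ?N _ ?N _ ?N])
  \<comment> \<open>The first column of \<open>W\<close> is an eigenvector of \<open>A\<close>.\<close>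
  have AW0: "(A * W) $$ (r, 0) = e * W $$ (r, 0)" if r: "r < ?N" for r
  proof -
    have "(A * W) $$ (r, 0) = c * (\<Sum>k<?N. A $$ (r, k) * v $ k)"
      unfolding mat_mult_index[OF A W(1) r zero_less_Suc] sum_distrib_left
      by (intro sum.cong refl) (simp add: W0)
    also have "(\<Sum>k<?N. A $$ (r, k) * v $ k) = (A *\<^sub>v v) $ r"
      using r A v(1) by (simp add: scalar_prod_def atLeast0LessThan del: sum.lessThan_Suc)
    also have "c * \<dots> = e * W $$ (r, 0)" using r v(1) by (simp add: v(3) W0)
    finally show ?thesis .
  qed
  have B0: "B $$ (i, 0) = (if i = 0 then e else 0)" if i: "i < ?N" for i
  proof -
    have "B $$ (i, 0) = e * (\<Sum>k<?N. cnj (W $$ (k, i)) * W $$ (k, 0))"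
      unfolding B_def mat_mult_index[OF Wa AW i zero_less_Suc] sum_distrib_left
      by (intro sum.cong refl) (simp add: AW0 mat_adjoint_index[OF W(1)] i)
    then show ?thesis using unitary_index(1)[OF W i zero_less_Suc] by simp
  qed
  have Bc: "B $$ (j, i) = cnj (B $$ (i, j))" if "i < ?N" "j < ?N" for i j
    using mat_adjoint_index[OF B that(2,1)] unfolding hB .
  have er: "e = of_real (Re e)"
    using Bc[of 0 0] B0[of 0] by (simp add: complex_eq_iff)
  define C where "C = mat N N (\<lambda>(i, j). B $$ (Suc i, Suc j))"
  have C: "C \<in> carrier_mat N N" by (simp add: C_def)
  have "mat_adjoint C = C"
  proof (rule eq_matI)
    fix i j assume "i < dim_row C" "j < dim_col C"
    then have ij: "i < N" "j < N" using C by auto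
    show "mat_adjoint C $$ (i, j) = C $$ (i, j)"
      unfolding mat_adjoint_index[OF C ij] using Bc[of "Suc j" "Suc i"] ij by (simp add: C_def)
  qed (use C mat_adjoint_carrier[OF C] in auto)
  then obtain V d where V: "V \<in> carrier_mat N N" "mat_adjoint V * V = 1\<^sub>m N"
    and CV: "C = V * mat_diag N (\<lambda>i. of_real (d i)) * mat_adjoint V"
    using Suc.IH[OF C] by blast
  \<comment> \<open>\<open>X\<close> is the block diagonal sum of \<open>1\<close> and \<open>V\<close>.\<close>
  define X where "X = mat ?N ?N (\<lambda>(i, j). case (i, j) of
    (Suc i', Suc j') \<Rightarrow> V $$ (i', j') | _ \<Rightarrow> if i = j then 1 else 0)"
  define d' where "d' i = (case i of 0 \<Rightarrow> Re e | Suc i' \<Rightarrow> d i')" for i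
  have X: "X \<in> carrier_mat ?N ?N" by (simp add: X_def)
  have Xu: "mat_adjoint X * X = 1\<^sub>m ?N"
  proof (rule unitaryI[OF X])
    fix i j assume ij: "i < ?N" "j < ?N"
    show "(\<Sum>k<?N. cnj (X $$ (k, i)) * X $$ (k, j)) = (if i = j then 1 else 0)"
      using ij unitary_index(1)[OF V] unfolding sum.lessThan_Suc_shift
      by (cases i; cases j) (simp_all add: X_def)
  qed
  have "B = X * mat_diag ?N (\<lambda>i. of_real (d' i)) * mat_adjoint X"
  proof (rule eq_matI)
    show "dim_row B = dim_row (X * mat_diag ?N (\<lambda>i. of_real (d' i)) * mat_adjoint X)"
      "dim_col B = dim_col (X * mat_diag ?N (\<lambda>i. of_real (d' i)) * mat_adjoint X)"
      using B X mat_adjoint_carrier[OF X] by auto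
    fix i j assume "i < dim_row (X * mat_diag ?N (\<lambda>i. of_real (d' i)) * mat_adjoint X)"
      "j < dim_col (X * mat_diag ?N (\<lambda>i. of_real (d' i)) * mat_adjoint X)"
    then have ij: "i < ?N" "j < ?N" using X mat_adjoint_carrier[OF X] by auto
    have CVi: "B $$ (Suc i', Suc j') = (\<Sum>k<N. V $$ (i', k) * of_real (d k) * cnj (V $$ (j', k)))"
      if "i' < N" "j' < N" for i' j'
      using unitary_diag_index[OF V(1) that, of "\<lambda>i. of_real (d i)"] that
      unfolding CV[symmetric] by (simp add: C_def)
    show "B $$ (i, j) = (X * mat_diag ?N (\<lambda>i. of_real (d' i)) * mat_adjoint X) $$ (i, j)"
      unfolding unitary_diag_index[OF X ij] sum.lessThan_Suc_shift
      using ij B0[of i] B0[of j] Bc[of j 0] er CVi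
      by (cases i; cases j) (simp_all add: X_def d'_def)
  qed
  note BX = this
  let ?D = "mat_diag ?N (\<lambda>i. complex_of_real (d' i))"
  note Xa = mat_adjoint_carrier[OF X]
  have Dc: "?D \<in> carrier_mat ?N ?N" by simp
  have WXa: "mat_adjoint (W * X) = mat_adjoint X * mat_adjoint W" by (rule mat_adjoint_mult[OF W(1) X])
  have "mat_adjoint (W * X) * (W * X) = mat_adjoint X * (mat_adjoint W * W) * X"
    unfolding WXa using W(1) Wa X Xa by (simp add: assoc_mult_mat[of _ ?N ?N _ ?N _ ?N])
  then have "mat_adjoint (W * X) * (W * X) = 1\<^sub>m ?N" using X Xa by (simp add: W(2) Xu)
  moreover have "A = (W * X) * ?D * mat_adjoint (W * X)"
    unfolding WXa using W(1) Wa X Xa Dc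
    by (subst AB, subst BX) (simp add: assoc_mult_mat[of _ ?N ?N _ ?N _ ?N] del: mat_diag_dim)
  moreover have "W * X \<in> carrier_mat ?N ?N" using W(1) X by simp
  ultimately show ?case by blast
qed

lemma ntr_unitary_diag:
  assumes U: "U \<in> carrier_mat N N" "mat_adjoint U * U = 1\<^sub>m N"
  shows "ntr (U * mat_diag N e * mat_adjoint U) = (\<Sum>k<N. e k) / of_nat N"
proof -
  have "(\<Sum>i<N. (U * mat_diag N e * mat_adjoint U) $$ (i, i))
      = (\<Sum>k<N. e k * (\<Sum>i<N. cnj (U $$ (i, k)) * U $$ (i, k)))"
    unfolding sum_distrib_left
    by (subst sum.swap, intro sum.cong refl) (simp add: unitary_diag_index[OF U(1)] mult_ac)
  also have "\<dots> = (\<Sum>k<N. e k)"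
    by (intro sum.cong refl) (simp add: unitary_index(1)[OF U])
  finally show ?thesis using U(1) by (simp add: ntr_def)
qed

lemma unitary_diag_mult:
  fixes e e' :: "nat \<Rightarrow> complex"
  assumes U: "U \<in> carrier_mat N N" "mat_adjoint U * U = 1\<^sub>m N"
  shows "(U * mat_diag N e * mat_adjoint U) * (U * mat_diag N e' * mat_adjoint U)
    = U * mat_diag N (\<lambda>i. e i * e' i) * mat_adjoint U"
proof -
  note Ua = mat_adjoint_carrier[OF U(1)]
  have D: "mat_diag N f \<in> carrier_mat N N" for f :: "nat \<Rightarrow> complex" by simp
  have "(U * mat_diag N e * mat_adjoint U) * (U * mat_diag N e' * mat_adjoint U)
      = U * (mat_diag N e * ((mat_adjoint U * U) * mat_diag N e')) * mat_adjoint U"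
    using U(1) Ua D[of e] D[of e']
    by (simp add: assoc_mult_mat[of _ N N _ N _ N] del: mat_diag_dim mat_diag_diag)
  also have "\<dots> = U * (mat_diag N e * mat_diag N e') * mat_adjoint U"
    unfolding U(2) left_mult_one_mat[OF D] ..
  finally show ?thesis by simp
qed

lemma psd_powr_mat_abs_hermitian:
  fixes d :: "nat \<Rightarrow> real"
  assumes U: "U \<in> carrier_mat N N" "mat_adjoint U * U = 1\<^sub>m N"
    and A: "A = U * mat_diag N (\<lambda>i. of_real (d i)) * mat_adjoint U" "mat_adjoint A = A"
  shows "psd_powr (mat_abs A) p = U * mat_diag N (\<lambda>i. of_real (\<bar>d i\<bar> powr p)) * mat_adjoint U"
proof -
  have sq: "((d i)\<^sup>2) powr (1 / 2) = \<bar>d i\<bar>" for i by (simp add: powr_half_sqrt)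
  have "mat_adjoint A * A = U * mat_diag N (\<lambda>i. of_real ((d i)\<^sup>2)) * mat_adjoint U"
    unfolding A(2) by (subst (1 2) A(1)) (simp add: unitary_diag_mult[OF U] power2_eq_square)
  then have "mat_abs A = U * mat_diag N (\<lambda>i. of_real \<bar>d i\<bar>) * mat_adjoint U"
    unfolding mat_abs_def by (intro psd_powr_eqI) (unfold is_psd_powr_def,
      intro exI[of _ N] exI[of _ U] exI[of _ "\<lambda>i. (d i)\<^sup>2"], simp add: sq U)
  then show ?thesis
    by (intro psd_powr_eqI) (unfold is_psd_powr_def,
      intro exI[of _ N] exI[of _ U] exI[of _ "\<lambda>i. \<bar>d i\<bar>"], simp add: U)
qed

lemma Lp_norm_hermitian:
  fixes d :: "nat \<Rightarrow> real"
  assumes U: "U \<in> carrier_mat N N" "mat_adjoint U * U = 1\<^sub>m N"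
    and A: "A = U * mat_diag N (\<lambda>i. of_real (d i)) * mat_adjoint U" "mat_adjoint A = A"
  shows "Lp_norm p A = ((\<Sum>i<N. \<bar>d i\<bar> powr p) / N) powr (1 / p)"
  unfolding Lp_norm_def psd_powr_mat_abs_hermitian[OF assms] ntr_unitary_diag[OF U]
  by (simp add: Re_divide_of_nat flip: of_real_sum)

lemma ntr_psd_powr_2_hermitian:
  assumes A: "A \<in> carrier_mat N N" "mat_adjoint A = A"
  shows "Re (ntr (psd_powr (mat_abs A) 2)) = (\<Sum>r<N. \<Sum>c<N. (cmod (A $$ (r, c)))\<^sup>2) / N"
proof -
  obtain U and d :: "nat \<Rightarrow> real" where U: "U \<in> carrier_mat N N" "mat_adjoint U * U = 1\<^sub>m N"
    and AU: "A = U * mat_diag N (\<lambda>i. of_real (d i)) * mat_adjoint U"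
    using hermitian_diagonalization[OF A] by blast
  have "psd_powr (mat_abs A) 2 = U * mat_diag N (\<lambda>i. of_real (d i) * of_real (d i)) * mat_adjoint U"
    unfolding psd_powr_mat_abs_hermitian[OF U AU A(2)] by (simp add: power2_eq_square)
  also have "\<dots> = A * A" unfolding unitary_diag_mult[OF U, symmetric] AU[symmetric] ..
  finally have "ntr (psd_powr (mat_abs A) 2) = (\<Sum>r<N. (A * A) $$ (r, r)) / of_nat N"
    using A(1) by (simp add: ntr_def)
  also have "(\<Sum>r<N. (A * A) $$ (r, r)) = of_real (\<Sum>r<N. \<Sum>c<N. (cmod (A $$ (r, c)))\<^sup>2)"
    unfolding of_real_sum complex_norm_square
  proof (intro sum.cong refl)
    fix r assume "r \<in> {..<N}"
    then have r: "r < N" by simp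
    show "(A * A) $$ (r, r) = (\<Sum>c<N. A $$ (r, c) * cnj (A $$ (r, c)))"
      unfolding mat_mult_index[OF A(1) A(1) r r]
      by (intro sum.cong refl) (use mat_adjoint_index[OF A(1) _ r] r in \<open>simp add: A(2)\<close>)
  qed
  finally show ?thesis by (simp add: Re_divide_of_nat)
qed

section \<open>From 2-norms to 1-norms by duality\<close>

abbreviation kernel_of :: "complex mat \<Rightarrow> kernel" where
  "kernel_of A \<equiv> \<lambda>r c. A $$ (r, c)"

lemma Lp_norm_2_hermitian:
  assumes A: "A \<in> carrier_mat (2 ^ n) (2 ^ n)" "mat_adjoint A = A"
  shows "Lp_norm 2 A = hs_norm n (kernel_of A)"
  unfolding Lp_norm_def ntr_psd_powr_2_hermitian[OF A] hs_norm_def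
  by (simp add: powr_half_sqrt sum_nonneg)

text \<open>
  The interpolated duality \<open>|tr(A h)| \<le> \<parallel>A\<parallel>\<^sub>1\<^bsup>1/2\<^esup> \<parallel>A\<parallel>\<^sub>2\<^bsup>1/2\<^esup> \<parallel>h\<parallel>\<^sub>4\<close>, squared. In an orthonormal eigenbasis
  \<open>u\<^sub>k\<close> of \<open>A\<close> with eigenvalues \<open>d\<^sub>k\<close>, the unnormalized trace of \<open>A h\<close> is \<open>\<Sum>\<^sub>k d\<^sub>k H\<^sub>k\<close> with \<open>H\<^sub>k = \<langle>u\<^sub>k, h u\<^sub>k\<rangle>\<close>. Two applications of
  Cauchy-Schwarz split off \<open>\<Sum>\<^sub>k |d\<^sub>k|\<close> and \<open>\<Sum>\<^sub>k d\<^sub>k\<^sup>2\<close> and leave \<open>\<Sum>\<^sub>k |H\<^sub>k|\<^sup>4\<close>, which is at most the unnormalized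
  trace of \<open>(h\<^sup>* h)\<^sup>2\<close>.
\<close>
theorem duality_bound:
  assumes A: "A \<in> carrier_mat (2 ^ n) (2 ^ n)" "mat_adjoint A = A"
  shows "(cmod (hs_inner n (kernel_of A) h))\<^sup>2
    \<le> Lp_norm 1 A * Lp_norm 2 A * hs_norm n (gram n h h)"
proof -
  let ?N = "2 ^ n :: nat"
  obtain U and d :: "nat \<Rightarrow> real" where U: "U \<in> carrier_mat ?N ?N" "mat_adjoint U * U = 1\<^sub>m ?N"
    and AU: "A = U * mat_diag ?N (\<lambda>i. of_real (d i)) * mat_adjoint U"
    using hermitian_diagonalization[OF A] by blast
  define u where "u k r = U $$ (r, k)" for k r
  define ap where "ap M k r = (\<Sum>c<?N. M r c * u k c)" for M :: kernel and k r
  define H where "H k = (\<Sum>r<?N. cnj (u k r) * ap h k r)" for k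
  define G where "G = gram n h h"
  have L2: "(\<Sum>i\<in>I. \<bar>x i\<bar> * \<bar>y i\<bar>) \<le> sqrt (\<Sum>i\<in>I. (x i)\<^sup>2) * sqrt (\<Sum>i\<in>I. (y i)\<^sup>2)"
    for x y :: "nat \<Rightarrow> real" and I
    using L2_set_mult_ineq[of x y I] by (simp add: L2_set_def)
  have unit: "(\<Sum>r<?N. (cmod (u k r))\<^sup>2) = 1" if k: "k < ?N" for k
  proof -
    have "complex_of_real (\<Sum>r<?N. (cmod (u k r))\<^sup>2) = 1"
      using unitary_index(1)[OF U k k] unfolding of_real_sum complex_norm_square u_def
      by (simp add: mult.commute)
    then show ?thesis using of_real_eq_1_iff by blast
  qed
  \<comment> \<open>\<open>|\<langle>u\<^sub>k, M u\<^sub>k\<rangle>| \<le> \<parallel>M u\<^sub>k\<parallel>\<close>; used below both for \<open>M = h\<close> and for \<open>M = h\<^sup>* h\<close>.\<close>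
  have quad: "(cmod (\<Sum>r<?N. cnj (u k r) * ap M k r))\<^sup>2 \<le> (\<Sum>r<?N. (cmod (ap M k r))\<^sup>2)"
    if k: "k < ?N" for M k
  proof -
    have "cmod (\<Sum>r<?N. cnj (u k r) * ap M k r) \<le> (\<Sum>r<?N. \<bar>cmod (u k r)\<bar> * \<bar>cmod (ap M k r)\<bar>)"
      by (intro sum_norm_le) (simp add: norm_mult)
    also have "\<dots> \<le> sqrt (\<Sum>r<?N. (cmod (ap M k r))\<^sup>2)"
      using L2[of "\<lambda>r. cmod (u k r)" "\<lambda>r. cmod (ap M k r)" "{..<?N}"] by (simp add: unit[OF k])
    finally have "(cmod (\<Sum>r<?N. cnj (u k r) * ap M k r))\<^sup>2 \<le> (sqrt (\<Sum>r<?N. (cmod (ap M k r))\<^sup>2))\<^sup>2"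
      by (rule power_mono) simp
    then show ?thesis by (simp add: sum_nonneg)
  qed
  \<comment> \<open>The Hilbert-Schmidt norm can be computed in any orthonormal basis.\<close>
  have inv: "(\<Sum>k<?N. \<Sum>r<?N. (cmod (ap M k r))\<^sup>2) = (\<Sum>r<?N. \<Sum>c<?N. (cmod (M r c))\<^sup>2)" for M
  proof -
    have "complex_of_real (\<Sum>k<?N. \<Sum>r<?N. (cmod (ap M k r))\<^sup>2) =
      (\<Sum>k<?N. \<Sum>r<?N. \<Sum>c<?N. \<Sum>c'<?N. M r c * cnj (M r c') * (u k c * cnj (u k c')))"
      unfolding of_real_sum complex_norm_square ap_def cnj_sum sum_product
      by (intro sum.cong refl) (simp add: mult_ac)
    also have "\<dots> = (\<Sum>r<?N. \<Sum>c<?N. \<Sum>c'<?N. \<Sum>k<?N. M r c * cnj (M r c') * (u k c * cnj (u k c')))"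
      by (subst sum.swap, subst (2) sum.swap, subst (3) sum.swap) (rule refl)
    also have "\<dots> = (\<Sum>r<?N. \<Sum>c<?N. \<Sum>c'<?N. if c = c' then M r c * cnj (M r c') else 0)"
      unfolding sum_distrib_left[symmetric] u_def
      by (intro sum.cong refl) (simp add: unitary_index(2)[OF U])
    also have "\<dots> = complex_of_real (\<Sum>r<?N. \<Sum>c<?N. (cmod (M r c))\<^sup>2)"
      unfolding of_real_sum complex_norm_square by (intro sum.cong refl) simp
    finally show ?thesis using of_real_eq_iff by blast
  qed
  \<comment> \<open>\<open>\<parallel>h u\<^sub>k\<parallel>\<^sup>2 = \<langle>u\<^sub>k, h\<^sup>* h u\<^sub>k\<rangle>\<close>\<close>
  have apG: "complex_of_real (\<Sum>r<?N. (cmod (ap h k r))\<^sup>2) = (\<Sum>r<?N. cnj (u k r) * ap G k r)" for k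
  proof -
    have "complex_of_real (\<Sum>l<?N. (cmod (ap h k l))\<^sup>2)
        = (\<Sum>l<?N. \<Sum>r<?N. \<Sum>c<?N. cnj (h l r * u k r) * (h l c * u k c))"
      unfolding of_real_sum complex_norm_square ap_def cnj_sum
      by (subst mult.commute) (simp only: sum_product)
    also have "\<dots> = (\<Sum>r<?N. \<Sum>c<?N. \<Sum>l<?N. cnj (h l r * u k r) * (h l c * u k c))"
      by (subst sum.swap, subst (2) sum.swap) (rule refl)
    also have "\<dots> = (\<Sum>r<?N. cnj (u k r) * ap G k r)"
      unfolding ap_def G_def gram_def sum_distrib_left sum_distrib_right
      by (intro sum.cong refl) (simp add: mult_ac)
    finally show ?thesis .
  qed
  have H4: "(\<Sum>k<?N. ((cmod (H k))\<^sup>2)\<^sup>2) \<le> (\<Sum>r<?N. \<Sum>c<?N. (cmod (G r c))\<^sup>2)"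
    unfolding inv[of G, symmetric]
  proof (rule sum_mono)
    fix k assume "k \<in> {..<?N}"
    then have k: "k < ?N" by simp
    have "((cmod (H k))\<^sup>2)\<^sup>2 \<le> (\<Sum>r<?N. (cmod (ap h k r))\<^sup>2)\<^sup>2"
      unfolding H_def by (intro power_mono quad[OF k]) simp
    also have "\<dots> = (cmod (complex_of_real (\<Sum>r<?N. (cmod (ap h k r))\<^sup>2)))\<^sup>2"
      unfolding norm_of_real by simp
    also have "\<dots> \<le> (\<Sum>r<?N. (cmod (ap G k r))\<^sup>2)"
      unfolding apG by (rule quad[OF k])
    finally show "((cmod (H k))\<^sup>2)\<^sup>2 \<le> (\<Sum>r<?N. (cmod (ap G k r))\<^sup>2)" .
  qed
  have "(\<Sum>r<?N. \<Sum>c<?N. cnj (A $$ (r, c)) * h r c)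
      = (\<Sum>r<?N. \<Sum>c<?N. \<Sum>k<?N. of_real (d k) * (cnj (u k r) * (h r c * u k c)))"
    by (intro sum.cong refl, subst AU)
      (simp add: unitary_diag_index[OF U(1)] u_def sum_distrib_left mult_ac)
  also have "\<dots> = (\<Sum>k<?N. of_real (d k) * H k)"
    unfolding H_def ap_def sum_distrib_left
    by (subst (2) sum.swap, subst sum.swap) (rule refl)
  finally have ip: "hs_inner n (kernel_of A) h = (\<Sum>k<?N. of_real (d k) * H k) / 2 ^ n"
    by (simp add: hs_inner_def)
  define t1 t2 S where "t1 = (\<Sum>k<?N. \<bar>d k\<bar>)" and "t2 = (\<Sum>k<?N. (d k)\<^sup>2)"
    and "S = (\<Sum>r<?N. \<Sum>c<?N. (cmod (G r c))\<^sup>2)"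
  have t1: "t1 \<ge> 0" and t2: "t2 \<ge> 0" and S: "S \<ge> 0"
    by (simp_all add: t1_def t2_def S_def sum_nonneg)
  have "cmod (\<Sum>k<?N. of_real (d k) * H k) \<le> (\<Sum>k<?N. \<bar>sqrt \<bar>d k\<bar>\<bar> * \<bar>sqrt \<bar>d k\<bar> * cmod (H k)\<bar>)"
    by (intro sum_norm_le) (simp add: norm_mult abs_mult flip: mult.assoc)
  also have "\<dots> \<le> sqrt t1 * sqrt (\<Sum>k<?N. \<bar>d k\<bar> * (cmod (H k))\<^sup>2)"
    using L2[of "\<lambda>k. sqrt \<bar>d k\<bar>" "\<lambda>k. sqrt \<bar>d k\<bar> * cmod (H k)" "{..<?N}"]
    by (simp add: t1_def power_mult_distrib)
  finally have "(cmod (\<Sum>k<?N. of_real (d k) * H k))\<^sup>2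
      \<le> (sqrt t1 * sqrt (\<Sum>k<?N. \<bar>d k\<bar> * (cmod (H k))\<^sup>2))\<^sup>2"
    by (rule power_mono) simp
  also have "\<dots> = t1 * (\<Sum>k<?N. \<bar>d k\<bar> * (cmod (H k))\<^sup>2)"
    using t1 by (simp add: power_mult_distrib sum_nonneg)
  also have "\<dots> \<le> t1 * (sqrt t2 * sqrt (\<Sum>k<?N. ((cmod (H k))\<^sup>2)\<^sup>2))"
    using L2[of d "\<lambda>k. (cmod (H k))\<^sup>2" "{..<?N}"] t1 by (intro mult_left_mono) (simp_all add: t2_def)
  also have "\<dots> \<le> t1 * (sqrt t2 * sqrt S)"
    using H4 t1 t2 unfolding S_def by (intro mult_left_mono) simp_all
  finally have main: "(cmod (\<Sum>k<?N. of_real (d k) * H k))\<^sup>2 \<le> t1 * (sqrt t2 * sqrt S)" .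
  have n1: "Lp_norm 1 A = t1 / 2 ^ n"
    unfolding Lp_norm_hermitian[OF U AU A(2)] t1_def by (simp add: sum_nonneg)
  have n2: "Lp_norm 2 A = sqrt t2 / sqrt (2 ^ n)"
    unfolding Lp_norm_hermitian[OF U AU A(2)] t2_def
    by (simp add: powr_half_sqrt sum_nonneg real_sqrt_divide)
  have nG: "hs_norm n G = sqrt S / sqrt (2 ^ n)"
    by (simp add: hs_norm_def S_def real_sqrt_divide)
  have "(cmod (hs_inner n (kernel_of A) h))\<^sup>2 = (cmod (\<Sum>k<?N. of_real (d k) * H k))\<^sup>2 / (2 ^ n)\<^sup>2"
    unfolding ip by (simp add: norm_divide norm_power power_divide)
  also have "\<dots> \<le> t1 * (sqrt t2 * sqrt S) / (2 ^ n)\<^sup>2"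
    by (rule divide_right_mono[OF main]) simp
  also have "\<dots> = Lp_norm 1 A * Lp_norm 2 A * hs_norm n G"
    unfolding n1 n2 nG by (simp add: power2_eq_square mult.assoc)
  finally show ?thesis unfolding G_def .
qed

text \<open>
  The level inequality: duality tested against the twice depolarized matrix, whose 4-norm is
  controlled by hypercontractivity in terms of the left-hand side itself.
\<close>
corollary depolarize_energy_le:
  assumes A: "A \<in> carrier_mat (2 ^ n) (2 ^ n)" "mat_adjoint A = A"
  shows "(hs_norm n (depolarize (1/3) n (kernel_of A)))\<^sup>2 \<le> Lp_norm 1 A * Lp_norm 2 A"
proof -
  let ?g = "depolarize (1/3) n (kernel_of A)"
  define E where "E = (hs_norm n ?g)\<^sup>2"
  have L: "Lp_norm 1 A \<ge> 0" "Lp_norm 2 A \<ge> 0" by (simp_all add: Lp_norm_def)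
  have "E\<^sup>2 = (cmod (hs_inner n (kernel_of A) (depolarize (1/3) n ?g)))\<^sup>2"
    unfolding hs_inner_depolarize_twice E_def by (simp only: norm_of_real abs_power2 power2_abs)
  also have "\<dots> \<le> Lp_norm 1 A * Lp_norm 2 A * hs_norm n (gram n (depolarize (1/3) n ?g) (depolarize (1/3) n ?g))"
    by (rule duality_bound[OF A])
  also have "\<dots> \<le> Lp_norm 1 A * Lp_norm 2 A * E"
    unfolding E_def using L by (intro mult_left_mono depolarize_hypercontractive) simp
  finally have "E * E \<le> Lp_norm 1 A * Lp_norm 2 A * E" by (simp add: power2_eq_square)
  moreover have "E \<ge> 0" by (simp add: E_def)
  ultimately show ?thesis
    using L unfolding E_def[symmetric] by (cases "E = 0") auto
qed

section \<open>Partial derivatives by entries\<close>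

lemma sum_pick:
  fixes r c a b :: nat and w :: complex
  assumes "r < a" "c < b"
  shows "(\<Sum>J<a. \<Sum>L<b. F J L * (if r = J \<and> c = L then w else 0)) = F r c * w"
proof -
  have "(\<Sum>J<a. \<Sum>L<b. F J L * (if r = J \<and> c = L then w else 0))
      = (\<Sum>J<a. \<Sum>L<b. if c = L then if r = J then F J L * w else 0 else 0)"
    by (intro sum.cong refl) simp
  also have "\<dots> = F r c * w" using assms by simp
  finally show ?thesis .
qed

text \<open>
  An identity in the left tensor factor lets the other map act on each block separately.
\<close>
lemma tensor_map_id_left:
  assumes ik: "i < a" "k < a" and rc: "r < b" "c < b"
    and \<Psi>: "\<And>J L. \<Psi> (unit_mat b J L) \<in> carrier_mat b b"
  shows "tensor_map a b id \<Psi> T $$ (i * b + r, k * b + c) =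
    (\<Sum>J<b. \<Sum>L<b. T $$ (i * b + J, k * b + L) * \<Psi> (unit_mat b J L) $$ (r, c))"
proof -
  have b: "b > 0" using rc by simp
  have lt: "x * b + y < a * b" if "x < a" "y < b" for x y
  proof -
    have "x * b + y < Suc x * b" using that by simp
    also have "\<dots> \<le> a * b" using that by (intro mult_right_mono) auto
    finally show ?thesis .
  qed
  have K: "kron (unit_mat a i' k') P $$ (i * b + r, k * b + c) =
      (if i = i' \<and> k = k' then 1 else 0) * P $$ (r, c)" if P: "P \<in> carrier_mat b b" for i' k' P
    using lt[OF ik(1) rc(1)] lt[OF ik(2) rc(2)] ik rc b P by (simp add: kron_def unit_mat_def)
  define F where "F i' k' = (\<Sum>J<b. \<Sum>L<b. T $$ (i' * b + J, k' * b + L) * \<Psi> (unit_mat b J L) $$ (r, c))"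
    for i' k'
  have "tensor_map a b id \<Psi> T $$ (i * b + r, k * b + c) =
    (\<Sum>i'<a. \<Sum>k'<a. \<Sum>J<b. \<Sum>L<b. T $$ (i' * b + J, k' * b + L) *
       kron (unit_mat a i' k') (\<Psi> (unit_mat b J L)) $$ (i * b + r, k * b + c))"
    using lt[OF ik(1) rc(1)] lt[OF ik(2) rc(2)] by (simp add: tensor_map_def)
  also have "\<dots> = (\<Sum>i'<a. \<Sum>k'<a. F i' k' * (if i = i' \<and> k = k' then 1 else 0))"
    unfolding K[OF \<Psi>] F_def sum_distrib_right by (simp only: mult_ac)
  finally show ?thesis unfolding sum_pick[OF ik] by (simp add: F_def)
qed

lemma tensor_map_D_map_id:
  assumes xy: "x < 2" "y < 2" and rc: "r < b" "c < b"
  shows "tensor_map 2 b D_map id Y $$ (x * b + r, y * b + c) =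
    (if x = y then (Y $$ (x * b + r, y * b + c) - Y $$ ((1 - x) * b + r, (1 - y) * b + c)) / 2
     else Y $$ (x * b + r, y * b + c))"
proof -
  have b: "b > 0" using rc by simp
  have lt: "z * b + s < 2 * b" if "z < 2" "s < b" for z s
    using that by (cases z) auto
  define Z where "Z = mat 2 2 (\<lambda>(i, k). Y $$ (i * b + r, k * b + c))"
  have Zc: "Z \<in> carrier_mat 2 2" by (simp add: Z_def)
  have K: "kron (D_map (unit_mat 2 i k)) (unit_mat b J L) $$ (x * b + r, y * b + c) =
      (if r = J \<and> c = L then D_map (unit_mat 2 i k) $$ (x, y) else 0)" for i k J L
    using lt[OF xy(1) rc(1)] lt[OF xy(2) rc(2)] rc b
    by (simp add: kron_def D_map_def) (simp add: unit_mat_def)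
  have "tensor_map 2 b D_map id Y $$ (x * b + r, y * b + c) =
    (\<Sum>i<2. \<Sum>k<2. \<Sum>J<b. \<Sum>L<b. Y $$ (i * b + J, k * b + L) *
        kron (D_map (unit_mat 2 i k)) (unit_mat b J L) $$ (x * b + r, y * b + c))"
    using lt[OF xy(1) rc(1)] lt[OF xy(2) rc(2)] by (simp add: tensor_map_def)
  also have "\<dots> = (\<Sum>i<2. \<Sum>k<2. Z $$ (i, k) * D_map (unit_mat 2 i k) $$ (x, y))"
    unfolding K sum_pick[OF rc] by (intro sum.cong refl) (simp add: Z_def)
  also have "\<dots> = D_map Z $$ (x, y)" by (rule D_map_expand[OF Zc xy, symmetric])
  also have "\<dots> = (if x = y then (Z $$ (x, y) - Z $$ (1 - x, 1 - y)) / 2 else Z $$ (x, y))"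
  proof -
    have "x = 0 \<or> x = 1" "y = 0 \<or> y = 1" using xy by auto
    then show ?thesis
      by (auto simp: D_map_def ntr_def Z_def numeral_2_eq_2 lessThan_Suc field_simps)
  qed
  finally show ?thesis using xy by (simp add: Z_def)
qed

text \<open>
  Here \<open>x\<close> is the bit at position \<open>m\<close>, while \<open>i\<close> and \<open>r\<close> collect the bits above and below it.
\<close>
lemma flip_bit_block:
  fixes i x r m :: nat
  assumes "x < 2" "r < 2 ^ m"
  shows "bit (i * (2 * 2 ^ m) + (x * 2 ^ m + r)) m \<longleftrightarrow> x = 1"
    and "flip_bit m (i * (2 * 2 ^ m) + (x * 2 ^ m + r)) = i * (2 * 2 ^ m) + ((1 - x) * 2 ^ m + r)"
proof -
  have x: "x = 0 \<or> x = 1" using assms(1) by auto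
  have bit: "bit (i * (2 * 2 ^ m) + (y * 2 ^ m + r)) m \<longleftrightarrow> odd y" for y
  proof -
    have "i * (2 * 2 ^ m) + (y * 2 ^ m + r) = (2 * i + y) * 2 ^ m + r" by (simp add: algebra_simps)
    then have "(i * (2 * 2 ^ m) + (y * 2 ^ m + r)) div 2 ^ m = 2 * i + y"
      using assms(2) by (simp only:) simp
    then show ?thesis unfolding bit_iff_odd by simp
  qed
  show "bit (i * (2 * 2 ^ m) + (x * 2 ^ m + r)) m \<longleftrightarrow> x = 1" using x by (auto simp: bit)
  have inv: "flip_bit m (flip_bit m z) = z" for z :: nat
    by (rule bit_eqI) (auto simp: bit_flip_bit_iff)
  have "flip_bit m (i * (2 * 2 ^ m) + r) = i * (2 * 2 ^ m) + (2 ^ m + r)"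
    using bit[of 0] by (simp add: flip_bit_eq_if set_bit_eq)
  with inv[of "i * (2 * 2 ^ m) + r"] x
  show "flip_bit m (i * (2 * 2 ^ m) + (x * 2 ^ m + r)) = i * (2 * 2 ^ m) + ((1 - x) * 2 ^ m + r)"
    by auto
qed

text \<open>
  The bit is \<open>n - j\<close> because the first tensor factor is the most significant one.
\<close>
lemma partial_deriv_index:
  assumes j: "1 \<le> j" "j \<le> n" and RC: "R < 2 ^ n" "C < 2 ^ n"
  shows "partial_deriv n j T $$ (R, C) = qubit_deriv (n - j) (kernel_of T) R C"
proof -
  define m where "m = n - j"
  let ?a = "2 ^ (j - 1) :: nat" and ?b = "2 ^ m :: nat"
  have "n = (j - 1) + Suc m" using j by (simp add: m_def)
  then have ab: "2 ^ n = ?a * (2 * ?b)" by (metis power_Suc power_add)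
  have split: "\<exists>i x r. R = i * (2 * ?b) + (x * ?b + r) \<and> i < ?a \<and> x < 2 \<and> r < ?b" if "R < 2 ^ n" for R
  proof (intro exI conjI)
    show "R = R div (2 * ?b) * (2 * ?b) + ((R mod (2 * ?b)) div ?b * ?b + R mod (2 * ?b) mod ?b)"
      by (simp only: div_mult_mod_eq)
    show "R div (2 * ?b) < ?a" using that unfolding ab by (simp add: less_mult_imp_div_less)
    show "R mod (2 * ?b) div ?b < 2" by (simp add: less_mult_imp_div_less)
    show "R mod (2 * ?b) mod ?b < ?b" by simp
  qed
  obtain i x r where R: "R = i * (2 * ?b) + (x * ?b + r)" "i < ?a" "x < 2" "r < ?b"
    using split[OF RC(1)] by blast
  obtain k y c where C: "C = k * (2 * ?b) + (y * ?b + c)" "k < ?a" "y < 2" "c < ?b"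
    using split[OF RC(2)] by blast
  have lt: "z * ?b + s < 2 * ?b" if "z < 2" "s < ?b" for z s
    using that by (cases z) auto
  define Y where "Y = mat (2 * ?b) (2 * ?b) (\<lambda>(J, L). T $$ (i * (2 * ?b) + J, k * (2 * ?b) + L))"
  let ?\<Psi> = "tensor_map 2 ?b D_map id"
  have "partial_deriv n j T $$ (R, C) = (\<Sum>J<2 * ?b. \<Sum>L<2 * ?b.
      T $$ (i * (2 * ?b) + J, k * (2 * ?b) + L) * ?\<Psi> (unit_mat (2 * ?b) J L) $$ (x * ?b + r, y * ?b + c))"
    unfolding partial_deriv_def m_def[symmetric] R(1) C(1)
    by (rule tensor_map_id_left[OF R(2) C(2) lt lt]) (use R C in \<open>auto simp: tensor_map_def\<close>)
  also have "\<dots> = (\<Sum>J<2 * ?b. \<Sum>L<2 * ?b.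
      Y $$ (J, L) * ?\<Psi> (unit_mat (2 * ?b) J L) $$ (x * ?b + r, y * ?b + c))"
    by (intro sum.cong refl) (simp add: Y_def)
  also have "\<dots> = ?\<Psi> Y $$ (x * ?b + r, y * ?b + c)"
    by (rule tensor_map_expand[symmetric]) (use R C lt in auto)
  also have "\<dots> = qubit_deriv m (kernel_of T) R C"
    unfolding tensor_map_D_map_id[OF R(3) C(3) R(4) C(4)] qubit_deriv_def R(1) C(1)
      flip_bit_block[OF R(3,4)] flip_bit_block[OF C(3,4)]
    using R(3,4) C(3,4) lt by (auto simp: Y_def)
  finally show ?thesis by (simp add: m_def)
qed

lemma partial_deriv_carrier:
  assumes "1 \<le> j" "j \<le> n"
  shows "partial_deriv n j T \<in> carrier_mat (2 ^ n) (2 ^ n)"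
proof -
  have "n = (j - 1) + Suc (n - j)" using assms by simp
  then have "2 ^ n = (2 ^ (j - 1) * (2 * 2 ^ (n - j)) :: nat)" by (metis power_Suc power_add)
  then show ?thesis by (simp add: partial_deriv_def tensor_map_def)
qed

lemma partial_deriv_hermitian:
  assumes j: "1 \<le> j" "j \<le> n" and T: "T \<in> carrier_mat (2 ^ n) (2 ^ n)" "mat_adjoint T = T"
  shows "mat_adjoint (partial_deriv n j T) = partial_deriv n j T"
proof (rule eq_matI)
  let ?P = "partial_deriv n j T"
  note P = partial_deriv_carrier[OF j, of T]
  show "dim_row (mat_adjoint ?P) = dim_row ?P" "dim_col (mat_adjoint ?P) = dim_col ?P"
    using P mat_adjoint_carrier[OF P] by auto
  fix r c assume "r < dim_row ?P" "c < dim_col ?P"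
  then have rc: "r < 2 ^ n" "c < 2 ^ n" using P by auto
  have Th: "cnj (T $$ (s, t)) = T $$ (t, s)" if "s < 2 ^ n" "t < 2 ^ n" for s t
    using mat_adjoint_index[OF T(1) that(2,1)] by (simp add: T(2))
  have "n - j < n" using j by simp
  note fl = top_bit(7)[OF rc(1) this] top_bit(7)[OF rc(2) this]
  show "mat_adjoint ?P $$ (r, c) = ?P $$ (r, c)"
    unfolding mat_adjoint_index[OF P rc] partial_deriv_index[OF j rc] partial_deriv_index[OF j rc(2,1)]
    by (auto simp: qubit_deriv_def Th rc fl)
qed

section \<open>The alternative for balanced projections\<close>

lemma hs_norm_depolarize_cong:
  fixes \<rho> :: real
  assumes "\<And>r c. r < 2 ^ n \<Longrightarrow> c < 2 ^ n \<Longrightarrow> f r c = g r c"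
  shows "hs_norm n (depolarize \<rho> n f) = hs_norm n (depolarize \<rho> n g)"
proof -
  have "(hs_norm n (depolarize \<rho> n f))\<^sup>2 = (hs_norm n (depolarize \<rho> n g))\<^sup>2"
    unfolding hs_norm_pauli_coeff
  proof (intro sum.cong refl)
    fix s assume "s \<in> pauli_strings n"
    then have s: "length s = n" by simp
    have "pauli_coeff s f = pauli_coeff s g"
      by (rule pauli_coeff_cong) (simp add: assms s)
    then show "(cmod (pauli_coeff s (depolarize \<rho> n f)))\<^sup>2 = (cmod (pauli_coeff s (depolarize \<rho> n g)))\<^sup>2"
      by (simp add: pauli_coeff_depolarize[OF s])
  qed
  then show ?thesis by simp
qed

text \<open>
  Tensor factor \<open>j\<close> corresponds to bit \<open>m = n - j\<close> of an index; the level inequality, applied to each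
  derivative, turns the bound by noisy derivatives into one by 1-norms and 2-norms.
\<close>
theorem variance_mat_le:
  assumes T: "T \<in> carrier_mat (2 ^ n) (2 ^ n)" "mat_adjoint T = T" and k: "k \<ge> 1"
    and L1: "\<And>j. j \<in> {1..n} \<Longrightarrow> Lp_norm 1 (partial_deriv n j T) \<le> \<alpha>"
    and L2: "\<And>j. j \<in> {1..n} \<Longrightarrow> Lp_norm 2 (partial_deriv n j T) \<le> \<beta>"
  shows "variance_mat T \<le> 9 ^ k * (n * (\<alpha> * \<beta>)) + n * \<beta>\<^sup>2 / k"
proof -
  have site: "(hs_norm n (depolarize (1/3) n (qubit_deriv m (kernel_of T))))\<^sup>2 \<le> \<alpha> * \<beta> \<and>
      (hs_norm n (qubit_deriv m (kernel_of T)))\<^sup>2 \<le> \<beta>\<^sup>2" if m: "m < n" for m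
  proof -
    define j where "j = n - m"
    have j: "1 \<le> j" "j \<le> n" "n - j = m" using m by (auto simp: j_def)
    let ?P = "partial_deriv n j T"
    note P = partial_deriv_carrier[OF j(1,2), of T] partial_deriv_hermitian[OF j(1,2) T]
    have eq: "qubit_deriv m (kernel_of T) r c = kernel_of ?P r c" if "r < 2 ^ n" "c < 2 ^ n" for r c
      using partial_deriv_index[OF j(1,2) that] by (simp add: j(3))
    have pos: "Lp_norm 1 ?P \<ge> 0" "Lp_norm 2 ?P \<ge> 0" by (simp_all add: Lp_norm_def)
    have le: "Lp_norm 1 ?P \<le> \<alpha>" "Lp_norm 2 ?P \<le> \<beta>" using L1[of j] L2[of j] j by auto
    have "(hs_norm n (depolarize (1/3) n (qubit_deriv m (kernel_of T))))\<^sup>2 \<le> Lp_norm 1 ?P * Lp_norm 2 ?P"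
      using depolarize_energy_le[OF P] hs_norm_depolarize_cong[OF eq, where \<rho> = "1/3"] by simp
    also have "\<dots> \<le> \<alpha> * \<beta>" using pos le by (intro mult_mono) auto
    finally have 1: "(hs_norm n (depolarize (1/3) n (qubit_deriv m (kernel_of T))))\<^sup>2 \<le> \<alpha> * \<beta>" .
    have "hs_norm n (qubit_deriv m (kernel_of T)) = Lp_norm 2 ?P"
      unfolding Lp_norm_2_hermitian[OF P] by (rule hs_norm_cong[OF eq])
    then show ?thesis using 1 pos le by (simp add: power_mono)
  qed
  have ntr: "ntr T = (\<Sum>r<2 ^ n. kernel_of T r r) / 2 ^ n"
    using T(1) by (simp add: ntr_def)
  have "variance_mat T = (hs_norm n (kernel_of T))\<^sup>2 - (cmod ((\<Sum>r<2 ^ n. kernel_of T r r) / 2 ^ n))\<^sup>2"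
    unfolding variance_mat_def ntr_psd_powr_2_hermitian[OF T] ntr hs_norm_power2 by simp
  also have "\<dots> \<le> 9 ^ k * (\<Sum>m<n. (hs_norm n (depolarize (1/3) n (qubit_deriv m (kernel_of T))))\<^sup>2)
    + (\<Sum>m<n. (hs_norm n (qubit_deriv m (kernel_of T)))\<^sup>2) / k"
    by (rule variance_le[OF k])
  also have "\<dots> \<le> 9 ^ k * (\<Sum>m<n. \<alpha> * \<beta>) + (\<Sum>m<n. \<beta>\<^sup>2) / k"
    using site by (intro add_mono mult_left_mono divide_right_mono sum_mono) auto
  finally show ?thesis by simp
qed

theorem theorem5p12:
  shows "\<exists>C::real. C > 0 \<and>
    (\<forall>(n::nat) (\<epsilon>::real) (T::complex mat).
       n \<ge> 1 \<longrightarrow> 0 < \<epsilon> \<longrightarrow> \<epsilon> < 1 \<longrightarrow>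
       T \<in> carrier_mat (2 ^ n) (2 ^ n) \<longrightarrow> projection T \<longrightarrow> balanced T \<longrightarrow>
         (MAX j\<in>{1..n}. (Lp_norm 2 (partial_deriv n j T))\<^sup>2) \<ge> C * \<epsilon> * ln (real n) / real n
       \<or> (MAX j\<in>{1..n}. Lp_norm 1 (partial_deriv n j T)) \<ge> C / real n powr ((1 + \<epsilon>) / 2))"
proof (rule exI[of _ "1 / 100"], intro conjI allI impI)
  fix n :: nat and \<epsilon> :: real and T :: "complex mat"
  assume n: "n \<ge> 1" and T: "T \<in> carrier_mat (2 ^ n) (2 ^ n)" "projection T" "balanced T"
  show "(MAX j\<in>{1..n}. (Lp_norm 2 (partial_deriv n j T))\<^sup>2) \<ge> 1 / 100 * \<epsilon> * ln (real n) / real n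
     \<or> (MAX j\<in>{1..n}. Lp_norm 1 (partial_deriv n j T)) \<ge> 1 / 100 / real n powr ((1 + \<epsilon>) / 2)"
  proof (rule ccontr, unfold de_Morgan_disj not_le, elim conjE)
    define L where "L = \<epsilon> * ln (real n)"
    define \<alpha> \<beta> where "\<alpha> = 1 / 100 / real n powr ((1 + \<epsilon>) / 2)" and "\<beta> = sqrt (L / 100 / n)"
    assume M2: "(MAX j\<in>{1..n}. (Lp_norm 2 (partial_deriv n j T))\<^sup>2) < 1 / 100 * \<epsilon> * ln (real n) / real n"
      and M1: "(MAX j\<in>{1..n}. Lp_norm 1 (partial_deriv n j T)) < 1 / 100 / real n powr ((1 + \<epsilon>) / 2)"
    have L1: "Lp_norm 1 (partial_deriv n j T) \<le> \<alpha>" if "j \<in> {1..n}" for j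
    proof -
      have "Lp_norm 1 (partial_deriv n j T) \<le> (MAX j\<in>{1..n}. Lp_norm 1 (partial_deriv n j T))"
        using that by (intro Max_ge) auto
      with M1 show ?thesis unfolding \<alpha>_def by simp
    qed
    have L2': "(Lp_norm 2 (partial_deriv n j T))\<^sup>2 < L / 100 / n" if "j \<in> {1..n}" for j
    proof -
      have "(Lp_norm 2 (partial_deriv n j T))\<^sup>2 \<le> (MAX j\<in>{1..n}. (Lp_norm 2 (partial_deriv n j T))\<^sup>2)"
        using that by (intro Max_ge) auto
      with M2 show ?thesis unfolding L_def by simp
    qed
    then have L2: "Lp_norm 2 (partial_deriv n j T) \<le> \<beta>" if "j \<in> {1..n}" for j
      unfolding \<beta>_def using that by (intro real_le_rsqrt less_imp_le)
    \<comment> \<open>If \<open>n = 1\<close> then \<open>L = 0\<close>, and the first alternative holds trivially.\<close>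
    have "0 \<le> (Lp_norm 2 (partial_deriv n 1 T))\<^sup>2" by simp
    also have "\<dots> < L / 100 / n" using n by (intro L2') simp
    finally have L0: "L > 0" using n by (simp add: zero_less_divide_iff)
    \<comment> \<open>Balance of the two terms: the cut-off must be of order \<open>L\<close> to make the second one small, and
      \<open>9 ^ k\<close> has to stay below \<open>exp (L / 2)\<close>, the gain over \<open>1 / n\<close> in \<open>\<alpha> * \<beta>\<close>; since \<open>ln 9 \<le> 3\<close>, one eighth of \<open>L\<close>
      leaves room for the factor \<open>sqrt L\<close> as well.\<close>
    define k where "k = nat \<lceil>L / 8\<rceil>"
    have k: "k \<ge> 1" "L / 8 \<le> k" "k \<le> L / 8 + 1"
      using L0 unfolding k_def by linarith+
    have "1 / 4 \<le> 9 ^ k * (n * (\<alpha> * \<beta>)) + n * \<beta>\<^sup>2 / k"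
      using variance_mat_le[OF T(1) _ k(1) L1 L2] T(2,3) unfolding projection_def balanced_def by metis
    \<comment> \<open>With the constant \<open>1/100\<close> the two terms are at most 0.08 and 0.018, together less than \<open>1/4\<close>.\<close>
    moreover have "n * \<beta>\<^sup>2 / k \<le> 8 / 100"
      using k L0 n by (simp add: \<beta>_def field_simps)
    moreover have "9 ^ k * (n * (\<alpha> * \<beta>)) \<le> 18 / 1000"
    proof -
      have sqrt_100: "sqrt 100 = 10" by (rule real_sqrt_unique) simp_all
      have "real n powr ((1 + \<epsilon>) / 2) = sqrt n * exp (L / 2)"
        unfolding add_divide_distrib powr_add using n powr_half_sqrt[of "real n"] by (simp add: powr_def L_def)
      then have "\<alpha> = exp (- (L / 2)) / (100 * sqrt n)"
        by (simp add: \<alpha>_def exp_minus field_simps)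
      moreover have "\<beta> = sqrt L / (10 * sqrt n)"
        by (simp add: \<beta>_def real_sqrt_divide real_sqrt_mult sqrt_100)
      ultimately have e: "n * (\<alpha> * \<beta>) = sqrt L * exp (- (L / 2)) / 1000"
        using n by simp
      have "sqrt L \<le> 2 * exp (L / 8)"
      proof (rule real_le_lsqrt)
        have "(2 * exp (L / 8))\<^sup>2 = 4 * exp (L / 4)"
          by (simp add: power_mult_distrib flip: exp_double)
        then show "L \<le> (2 * exp (L / 8))\<^sup>2" using exp_ge_add_one_self[of "L / 4"] by linarith
      qed (use L0 in simp_all)
      moreover have "9 ^ k \<le> 9 * exp (3 * L / 8)"
      proof -
        have "(3/2 :: real) ^ 6 \<le> exp (1/2) ^ 6"
          using exp_ge_add_one_self[of "1/2 :: real"] by (intro power_mono) auto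
        also have "exp (1/2 :: real) ^ 6 = exp 3" by (simp flip: exp_of_nat_mult)
        finally have "(9::real) \<le> exp 3" by (simp add: power_divide)
        then have ln9: "ln (9::real) \<le> 3" using ln_le_cancel_iff[of 9 "exp 3"] by simp
        have "(9::real) ^ k = exp (k * ln 9)" by (simp add: exp_of_nat_mult)
        also have "\<dots> \<le> exp ((L / 8 + 1) * ln 9)" using k(3) by simp
        also have "\<dots> = 9 * exp (L / 8 * ln 9)" by (simp add: ring_distribs exp_add)
        also have "\<dots> \<le> 9 * exp (3 * L / 8)" using ln9 L0 by simp
        finally show ?thesis .
      qed
      ultimately have "9 ^ k * (sqrt L * exp (- (L / 2)) / 1000)
          \<le> (9 * exp (3 * L / 8)) * ((2 * exp (L / 8)) * exp (- (L / 2)) / 1000)"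
        using L0 by (intro mult_mono divide_right_mono) simp_all
      also have "\<dots> = 18 / 1000 * exp (3 * L / 8 + L / 8 + - (L / 2))"
        unfolding exp_add by simp
      also have "\<dots> = 18 / 1000" by simp
      finally show ?thesis unfolding e .
    qed
    ultimately show False by simp
  qed
qed simp

end
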